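(* For every $w\in S_n$ ($n\geq1$), the Stanley symmetric function $F_w\in\mathsf{Sym}$ has saturated Newton polytope.
   Context: Let $\partial_i f=\frac{f-s_if}{x_i-x_{i+1}}$, where $s_i$ swaps $x_i,x_{i+1}$. For $w\in S_n$, the Schubert polynomial $\mathfrak{S}_w$ is defined by $\mathfrak{S}_{w_0}=x_1^{n-1}x_2^{n-2}\cdots x_{n-1}$ for $w_0=n\,n{-}1\cdots1$, and $\mathfrak{S}_w=\partial_i\mathfrak{S}_{ws_i}$ whenever $w(i)<w(i+1)$ (where $ws_i$ is $w$ with positions $i,i+1$ of its one-line notation swapped); this is well defined and unchanged under the inclusion $S_n\hookrightarrow S_{n+1}$. For $w\in S_n$ and $t\geq0$ let $1^t\times w\in S_{t+n}$ be given by $(1^t\times w)(i)=i$ for $i\leq t$ and $(1^t\times w)(i)=t+w(i-t)$ for $t<i\leq t+n$. The Stanley symmetric function is $F_w=\lim_{t\to\infty}\mathfrak{S}_{1^t\times w}$ (coefficientwise limit), an element of the ring $\mathsf{Sym}$ of symmetric functions in $x_1,x_2,\ldots$. A polynomial $g=\sum c_\alpha x^\alpha$ has saturated Newton polytope (SNP) if every lattice point of $\mathrm{conv}\{\alpha:c_\alpha\neq0\}$ is an exponent vector with nonzero coefficient; $f\in\mathsf{Sym}$ is SNP if $f(x_1,\ldots,x_m)$ (setting $x_i=0$ for $i>m$) is SNP for every $m\geq1$. *)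

theory Defs
  imports
    "HOL-Analysis.Analysis"
    "HOL-Analysis.Finite_Function_Topology"
    "HOL-Combinatorics.Permutations"
begin

text \<open>
  Exponent vectors are finitely supported functions from variable indices to \<^typ>\<open>nat\<close>, and
  polynomials are finitely supported functions from exponent vectors to \<^typ>\<open>int\<close>; the product
  on \<^type>\<open>poly_mapping\<close> is the convolution product. Variables are numbered from 1,
  as in the literature on Schubert polynomials; the index 0 is not used.
  A formal power series in infinitely many variables is an arbitrary function from exponent
  vectors to coefficients.
\<close>

type_synonym expo = "nat \<Rightarrow>\<^sub>0 nat"
type_synonym mpol = "expo \<Rightarrow>\<^sub>0 int"
type_synonym mseries = "expo \<Rightarrow> int"

definition X :: "nat \<Rightarrow> mpol" where
  "X i = Poly_Mapping.single (Poly_Mapping.single i 1) 1"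


section \<open>Schubert polynomials\<close>

text \<open>
  The outer \<^const>\<open>Poly_Mapping.map_key\<close> relabels the monomials, the inner one exchanges the
  entries of an exponent vector at positions \<open>i\<close> and \<open>i + 1\<close>. Both maps are involutions.
\<close>

definition swap_vars :: "nat \<Rightarrow> mpol \<Rightarrow> mpol" where
  "swap_vars i f = Poly_Mapping.map_key (Poly_Mapping.map_key (Transposition.transpose i (Suc i))) f"

text \<open>
  The quotient is taken in the polynomial ring. It exists, since the numerator
  vanishes for \<open>x\<^sub>i = x\<^sub>i\<^sub>+\<^sub>1\<close>, and it is unique, since the ring is an integral domain.
\<close>

definition div_diff :: "nat \<Rightarrow> mpol \<Rightarrow> mpol" where
  "div_diff i f = (THE g. (X i - X (Suc i)) * g = f - swap_vars i f)"

text \<open>A permutation in \<open>S\<^sub>n\<close> is a function on \<^typ>\<open>nat\<close> that permutes \<open>{1..n}\<close>.\<close>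

definition longest :: "nat \<Rightarrow> nat \<Rightarrow> nat" where
  "longest n i = (if i \<in> {1..n} then Suc n - i else i)"

text \<open>
  The polynomials derived from the two rules do not depend on the choice of the ascents,
  so that \<open>is_schubert n w\<close> holds for exactly one polynomial if \<open>w\<close> permutes \<open>{1..n}\<close>.
\<close>

inductive is_schubert :: "nat \<Rightarrow> (nat \<Rightarrow> nat) \<Rightarrow> mpol \<Rightarrow> bool" for n :: nat where
  longest: "is_schubert n (longest n) (\<Prod>i=1..n. X i ^ (n - i))"
| ascent: "w permutes {1..n} \<Longrightarrow> 1 \<le> i \<Longrightarrow> i < n \<Longrightarrow> w i < w (Suc i) \<Longrightarrow>
    is_schubert n (w \<circ> Transposition.transpose i (Suc i)) f \<Longrightarrow> is_schubert n w (div_diff i f)"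

definition schubert :: "nat \<Rightarrow> (nat \<Rightarrow> nat) \<Rightarrow> mpol" where
  "schubert n w = (THE f. is_schubert n w f)"


section \<open>Stanley symmetric functions\<close>

definition shift_perm :: "nat \<Rightarrow> (nat \<Rightarrow> nat) \<Rightarrow> nat \<Rightarrow> nat" where
  "shift_perm t w i = (if i \<le> t then i else t + w (i - t))"

text \<open>
  The type \<^typ>\<open>int\<close> carries the discrete topology, hence convergence of a sequence of
  coefficients means that it is eventually constant.
\<close>

definition stanley :: "nat \<Rightarrow> (nat \<Rightarrow> nat) \<Rightarrow> mseries" where
  "stanley n w = (\<lambda>\<alpha>. lim (\<lambda>t. Poly_Mapping.lookup (schubert (t + n) (shift_perm t w)) \<alpha>))"

definition total_degree :: "expo \<Rightarrow> nat" where
  "total_degree \<alpha> = (\<Sum>i\<in>Poly_Mapping.keys \<alpha>. Poly_Mapping.lookup \<alpha> i)"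

text \<open>
  The ring of symmetric functions over the integers: the power series in \<open>x\<^sub>1, x\<^sub>2, \<dots>\<close> of bounded
  degree that are invariant under permutations of the variables.
\<close>

definition Sym :: "mseries set" where
  "Sym = {f.
     (\<forall>\<alpha>. f \<alpha> \<noteq> 0 \<longrightarrow> Poly_Mapping.keys \<alpha> \<subseteq> {1..}) \<and>
     (\<exists>d. \<forall>\<alpha>. f \<alpha> \<noteq> 0 \<longrightarrow> total_degree \<alpha> \<le> d) \<and>
     (\<forall>\<pi> \<alpha>. \<pi> permutes {1..} \<longrightarrow> f (Poly_Mapping.map_key \<pi> \<alpha>) = f \<alpha>)}"


section \<open>Saturated Newton polytopes\<close>

definition real_vec :: "expo \<Rightarrow> (nat \<Rightarrow>\<^sub>0 real)" where
  "real_vec \<alpha> = Poly_Mapping.map real \<alpha>"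

definition newton_polytope :: "mpol \<Rightarrow> (nat \<Rightarrow>\<^sub>0 real) set" where
  "newton_polytope g = convex hull (real_vec ` Poly_Mapping.keys g)"

definition SNP :: "mpol \<Rightarrow> bool" where
  "SNP g \<longleftrightarrow> (\<forall>p \<in> newton_polytope g.
     (\<forall>i. Poly_Mapping.lookup p i \<in> \<int>) \<longrightarrow> p \<in> real_vec ` Poly_Mapping.keys g)"

text \<open>
  Setting \<open>x\<^sub>i = 0\<close> for \<open>i > m\<close> keeps exactly the monomials in \<open>x\<^sub>1, \<dots>, x\<^sub>m\<close>. For a series in
  \<open>Sym\<close> only finitely many of them have a nonzero coefficient, as its degree is bounded.
\<close>

definition restrict_vars :: "nat \<Rightarrow> mseries \<Rightarrow> mpol" where
  "restrict_vars m f = Abs_poly_mapping (\<lambda>\<alpha>. f \<alpha> when Poly_Mapping.keys \<alpha> \<subseteq> {1..m})"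

definition SNP_sym :: "mseries \<Rightarrow> bool" where
  "SNP_sym f \<longleftrightarrow> (\<forall>m\<ge>1. SNP (restrict_vars m f))"

end

theory Submission
  imports Defs
begin

text \<open>
  By Fomin and Stanley, the Schubert polynomials are the coefficients of a product of linear factors
  in the nilCoxeter algebra: divided differences act on this product as right multiplication by the
  generators. This shows that Schubert polynomials are well defined, and in the limit it exhibits
  \<open>F\<^sub>w\<close> as the generating function of the factorizations \<open>w = d\<^sub>1 d\<^sub>2 \<dots>\<close> into decreasing runs,
  where the factors belonging to different variables commute; hence \<open>F\<^sub>w\<close> is symmetric.

  Let \<open>r\<^sub>j\<close> be the number of values larger than \<open>j\<close> to the left of \<open>j\<close> in \<open>w\<close>. Each decreasing run
  raises each \<open>r\<^sub>j\<close> by at most one, so every exponent vector \<open>\<alpha>\<close> of \<open>F\<^sub>w\<close> in \<open>m\<close> variables satisfies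
  \<open>\<Sum>\<^sub>i \<alpha>\<^sub>i = \<Sum>\<^sub>j r\<^sub>j\<close> and \<open>\<Sum>\<^bsub>i\<in>S\<^esub> \<alpha>\<^sub>i \<le> \<Sum>\<^sub>j min |S| r\<^sub>j\<close> for all \<open>S \<subseteq> {1..m}\<close>. Conversely, a partial
  bubble sort pass can lower the \<open>c\<close> largest entries of \<open>r\<close> (ties broken from the left), and the greedy
  argument of Gale and Ryser shows that all these \<open>\<alpha>\<close> occur. A set of lattice points cut out by
  linear inequalities is saturated.
\<close>

section \<open>The Fomin-Stanley product\<close>

abbreviation adj :: "nat \<Rightarrow> nat \<Rightarrow> nat" where
  "adj i \<equiv> Transposition.transpose i (Suc i)"

text \<open>
  The nilCoxeter generators act from the right on functions \<open>\<phi>\<close> of a permutation: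
  \<open>(\<phi> u\<^sub>i) w\<close> is \<open>\<phi> (w s\<^sub>i)\<close> if \<open>w s\<^sub>i\<close> is shorter than \<open>w\<close>, and \<open>0\<close> otherwise. With this,
  \<open>nilh i x \<phi> = \<phi> (1 + x u\<^sub>i)\<close> and
  \<open>nilrun m k x \<phi> = \<phi> (1 + x u\<^bsub>m+k-1\<^esub>) \<dots> (1 + x u\<^sub>m)\<close>.
\<close>

definition nilh :: "nat \<Rightarrow> 'a::comm_ring_1 \<Rightarrow> ((nat \<Rightarrow> nat) \<Rightarrow> 'a) \<Rightarrow> (nat \<Rightarrow> nat) \<Rightarrow> 'a" where
  "nilh i x \<phi> w = \<phi> w + (if w (Suc i) < w i then x * \<phi> (w \<circ> adj i) else 0)"

fun nilrun :: "nat \<Rightarrow> nat \<Rightarrow> 'a::comm_ring_1 \<Rightarrow> ((nat \<Rightarrow> nat) \<Rightarrow> 'a) \<Rightarrow> (nat \<Rightarrow> nat) \<Rightarrow> 'a" where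
  "nilrun m 0 x \<phi> = \<phi>"
| "nilrun m (Suc k) x \<phi> = nilh m x (nilrun (Suc m) k x \<phi>)"

text \<open>The generators square to zero: once a descent at \<open>i\<close> has been undone, none
  is left there, so the cross term vanishes.\<close>

lemma nilh_add: "nilh i x (nilh i y \<phi>) = nilh i (x + y) \<phi>"
  by (rule ext) (simp add: nilh_def algebra_simps comp_assoc)

lemma nilh_zero [simp]: "nilh i 0 \<phi> = \<phi>"
  by (rule ext) (simp add: nilh_def)

lemma nilh_far_commute:
  assumes "Suc i < j"
  shows "nilh i x (nilh j y \<phi>) = nilh j y (nilh i x \<phi>)"
proof (rule ext)
  fix w :: "nat \<Rightarrow> nat"
  define a b where "a = adj i" and "b = adj j"
  have ap: "a j = j" "a (Suc j) = Suc j" "b i = i" "b (Suc i) = Suc i"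
    using assms by (auto simp: a_def b_def Transposition.transpose_def)
  have c: "w \<circ> a \<circ> b = w \<circ> b \<circ> a"
    using assms by (auto simp: fun_eq_iff a_def b_def Transposition.transpose_def)
  show "nilh i x (nilh j y \<phi>) w = nilh j y (nilh i x \<phi>) w"
    unfolding nilh_def a_def[symmetric] b_def[symmetric] comp_apply ap c
    by (cases "w (Suc i) < w i"; cases "w (Suc j) < w j") (simp_all add: algebra_simps)
qed

text \<open>The braid relation and the vanishing squares force the middle parameter to be the sum of
  the outer ones.\<close>

lemma nilh_yang_baxter:
  "nilh i x (nilh (Suc i) (x + y) (nilh i y \<phi>)) = nilh (Suc i) y (nilh i (x + y) (nilh (Suc i) x \<phi>))"
proof (rule ext)
  fix w :: "nat \<Rightarrow> nat"
  define a b where "a = adj i" and "b = adj (Suc i)"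
  have ap: "a i = Suc i" "a (Suc i) = i" "a (Suc (Suc i)) = Suc (Suc i)"
    "b i = i" "b (Suc i) = Suc (Suc i)" "b (Suc (Suc i)) = Suc i"
    by (auto simp: a_def b_def Transposition.transpose_def)
  have sq: "w \<circ> a \<circ> a = w" "w \<circ> b \<circ> b = w"
    by (simp_all add: a_def b_def comp_assoc)
  have braid: "w \<circ> a \<circ> b \<circ> a = w \<circ> b \<circ> a \<circ> b"
    by (auto simp: fun_eq_iff a_def b_def Transposition.transpose_def)
  have less: "w p < w q \<Longrightarrow> \<not> w q < w p" for p q by simp
  show "nilh i x (nilh (Suc i) (x + y) (nilh i y \<phi>)) w = nilh (Suc i) y (nilh i (x + y) (nilh (Suc i) x \<phi>)) w"
    unfolding nilh_def a_def[symmetric] b_def[symmetric] comp_apply ap sq braid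
    by (cases "w (Suc i) < w i"; cases "w (Suc (Suc i)) < w (Suc i)"; cases "w (Suc (Suc i)) < w i")
      (simp_all add: algebra_simps)
qed

lemma nilrun_nilh_commute:
  "Suc i < m \<Longrightarrow> nilrun m k x (nilh i y \<phi>) = nilh i y (nilrun m k x \<phi>)"
  by (induction k arbitrary: m) (simp_all add: nilh_far_commute)

text \<open>1 - x u_m is inverse to 1 + x u_m, so the last factor of a run can be cancelled.\<close>

lemma nilrun_Suc_left: "nilrun (Suc m) k x \<phi> = nilh m (- x) (nilrun m (Suc k) x \<phi>)"
  by (simp add: nilh_add)

lemma nilrun_commute: "nilrun m k x (nilrun m k y \<phi>) = nilrun m k y (nilrun m k x \<phi>)"
proof (induction k arbitrary: m rule: less_induct)
  case (less k)
  show ?case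
  proof (cases k)
    case 0
    then show ?thesis by simp
  next
    case [simp]: (Suc k')
    show ?thesis
    proof (cases k')
      case 0
      then show ?thesis by (simp add: nilh_add add.commute)
    next
      case Suc': (Suc l)
      \<comment> \<open>The tail of the outer run commutes with u_m. Written as the run from m+1
        with its last factor cancelled, it leaves two shorter runs, both from m+1, for the induction
        hypothesis.\<close>
      have expand: "nilrun m k x (nilrun m k y \<phi>)
          = nilh m x (nilh (Suc m) x (nilh m y (nilh (Suc m) (- x) (nilrun (Suc m) k' x (nilrun (Suc m) k' y \<phi>)))))" for x y
      proof -
        have "nilrun m k x (nilrun m k y \<phi>)
            = nilh m x (nilh (Suc m) x (nilrun (Suc (Suc m)) l x (nilh m y (nilrun (Suc m) k' y \<phi>))))"
          by (simp add: Suc')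
        also have "\<dots> = nilh m x (nilh (Suc m) x (nilh m y (nilrun (Suc (Suc m)) l x (nilrun (Suc m) k' y \<phi>))))"
          by (simp add: nilrun_nilh_commute)
        finally show ?thesis by (simp only: nilrun_Suc_left[of "Suc m" l] Suc')
      qed
      have swap: "nilh m x (nilh (Suc m) x (nilh m y (nilh (Suc m) (- x) \<psi>)))
          = nilh m y (nilh (Suc m) y (nilh m x (nilh (Suc m) (- y) \<psi>)))" for \<psi>
      proof -
        have "nilh m x (nilh (Suc m) x (nilh m y (nilh (Suc m) (- x) \<psi>)))
            = nilh m y (nilh m (x - y) (nilh (Suc m) (x - y + y) (nilh m y (nilh (Suc m) (- x) \<psi>))))"
          by (simp add: nilh_add)  \<comment> \<open>split off \<open>x = y + (x - y)\<close> to reach the Yang-Baxter shape\<close>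
        also have "\<dots> = nilh m y (nilh (Suc m) y (nilh m (x - y + y) (nilh (Suc m) (x - y) (nilh (Suc m) (- x) \<psi>))))"
          by (simp only: nilh_yang_baxter)
        finally show ?thesis by (simp add: nilh_add)
      qed
      have IH: "nilrun (Suc m) k' x (nilrun (Suc m) k' y \<phi>) = nilrun (Suc m) k' y (nilrun (Suc m) k' x \<phi>)"
        by (rule less) simp
      show ?thesis by (subst (1 2) expand) (simp only: IH swap)
    qed
  qed
qed

text \<open>The value at \<open>0\<close> is ignored so that \<open>delta\<close> is literally invariant under \<^const>\<open>shift_perm\<close>.\<close>

definition delta :: "(nat \<Rightarrow> nat) \<Rightarrow> 'a::comm_ring_1" where
  "delta w = (if \<forall>i\<ge>1. w i = i then 1 else 0)"

text \<open>
  The first \<open>j\<close> factors of the Fomin-Stanley product; for \<open>j = N\<close> its coefficient at \<open>w\<close> is the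
  Schubert polynomial of \<open>w \<in> S\<^sub>N\<close>, evaluated at \<open>z\<close>.
\<close>

fun sch :: "nat \<Rightarrow> (nat \<Rightarrow> 'a) \<Rightarrow> nat \<Rightarrow> (nat \<Rightarrow> nat) \<Rightarrow> 'a::comm_ring_1" where
  "sch N z 0 = delta"
| "sch N z (Suc j) = nilrun (Suc j) (N - Suc j) (z (Suc j)) (sch N z j)"

text \<open>
  Exchanging two neighbouring variables only changes one linear factor, since
  \<open>A\<^sub>i(x) A\<^bsub>i+1\<^esub>(y) = A\<^sub>i(x) A\<^sub>i(y) (1 - y u\<^sub>i)\<close> and the runs \<open>A\<^sub>i(x)\<close>, \<open>A\<^sub>i(y)\<close> commute.
\<close>

lemma sch_swap:
  assumes "1 \<le> i" "i < N" "Suc i \<le> j"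
  shows "\<exists>C. sch N z j = nilh i (- z (Suc i)) C \<and> sch N (z \<circ> adj i) j = nilh i (- z i) C"
  using assms(3)
proof (induction j rule: dec_induct)
  case base
  obtain i' where i': "i = Suc i'" using assms by (cases i) auto
  have P: "sch N (z \<circ> adj i) j = sch N z j" if "j < i" for j
    using that by (induction j) (auto simp: Transposition.transpose_def)
  have N: "N - i = Suc (N - Suc i)" using assms by simp
  define C where "C = nilrun i (N - i) (z (Suc i)) (nilrun i (N - i) (z i) (sch N z i'))"
  have "sch N z (Suc i) = nilrun (Suc i) (N - Suc i) (z (Suc i)) (nilrun i (N - i) (z i) (sch N z i'))"
    by (simp add: i')
  also have "\<dots> = nilh i (- z (Suc i)) C"
    by (simp only: C_def nilrun_Suc_left N)
  finally have 1: "sch N z (Suc i) = nilh i (- z (Suc i)) C" .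
  have "sch N (z \<circ> adj i) (Suc i) = nilrun (Suc i) (N - Suc i) (z i) (nilrun i (N - i) (z (Suc i)) (sch N z i'))"
    using P[of i'] by (simp add: i')
  also have "\<dots> = nilh i (- z i) C"
    by (simp only: C_def nilrun_Suc_left N nilrun_commute[of i _ "z (Suc i)"])
  finally show ?case using 1 by blast
next
  case (step j)
  from step.IH obtain C where C: "sch N z j = nilh i (- z (Suc i)) C" "sch N (z \<circ> adj i) j = nilh i (- z i) C"
    by blast
  \<comment> \<open>Later runs only use generators of index above i+1, which commute with
    u_i.\<close>
  have "sch N z (Suc j) = nilh i (- z (Suc i)) (nilrun (Suc j) (N - Suc j) (z (Suc j)) C)"
    using step C by (simp add: nilrun_nilh_commute)
  moreover have "sch N (z \<circ> adj i) (Suc j) = nilh i (- z i) (nilrun (Suc j) (N - Suc j) (z (Suc j)) C)"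
    using step C by (simp add: nilrun_nilh_commute Transposition.transpose_def)
  ultimately show ?case by blast
qed

text \<open>The ascent makes \<open>nilh i\<close> trivial at \<open>w\<close>, which leaves
  \<open>C w\<close>; at \<open>w \<circ> adj i\<close> the two evaluations differ by
  \<open>z i - z (Suc i)\<close> times \<open>C w\<close>.\<close>

lemma sch_div_diff:
  assumes "1 \<le> i" "i < N" "w i < w (Suc i)"
  shows "(z i - z (Suc i)) * sch N z N w
    = sch N z N (w \<circ> adj i) - sch N (z \<circ> adj i) N (w \<circ> adj i)"
proof -
  obtain C where "sch N z N = nilh i (- z (Suc i)) C" "sch N (z \<circ> adj i) N = nilh i (- z i) C"
    using sch_swap[of i N N z] assms by auto
  then show ?thesis
    using assms by (simp add: nilh_def comp_assoc algebra_simps)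
qed

section \<open>Renaming variables as a ring homomorphism\<close>

locale comm_ring_hom =
  fixes \<theta> :: "'a::comm_ring_1 \<Rightarrow> 'b::comm_ring_1"
  assumes hom_add: "\<theta> (f + g) = \<theta> f + \<theta> g"
    and hom_mult: "\<theta> (f * g) = \<theta> f * \<theta> g"
    and hom_one: "\<theta> 1 = 1"
begin

lemma hom_zero: "\<theta> 0 = 0"
  using hom_add[of 0 0] by simp

lemma hom_nilh: "\<theta> \<circ> nilh i x \<phi> = nilh i (\<theta> x) (\<theta> \<circ> \<phi>)"
  by (auto simp: fun_eq_iff nilh_def hom_add hom_mult hom_zero)

lemma hom_nilrun: "\<theta> \<circ> nilrun m k x \<phi> = nilrun m k (\<theta> x) (\<theta> \<circ> \<phi>)"
  by (induction k arbitrary: m) (simp_all add: hom_nilh)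

lemma hom_delta: "\<theta> \<circ> delta = delta"
  by (auto simp: fun_eq_iff delta_def hom_one hom_zero)

lemma hom_sch: "\<theta> \<circ> sch N z j = sch N (\<theta> \<circ> z) j"
proof (induction j)
  case (Suc j)
  show ?case unfolding sch.simps hom_nilrun Suc.IH by simp
qed (simp add: hom_delta)

end

text \<open>Extends \<open>swap_vars\<close>, the case of \<open>adj i\<close>, to arbitrary
  permutations, as the symmetry of the limit requires.\<close>

definition relabel :: "(nat \<Rightarrow> nat) \<Rightarrow> mpol \<Rightarrow> mpol" where
  "relabel \<pi> = Poly_Mapping.map_key (Poly_Mapping.map_key \<pi>)"

lemma map_key_inv:
  assumes "bij \<pi>"
  shows "Poly_Mapping.map_key \<pi> (Poly_Mapping.map_key (inv \<pi>) p) = p"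
    "Poly_Mapping.map_key (inv \<pi>) (Poly_Mapping.map_key \<pi> q) = q"
proof -
  have inj: "inj \<pi>" "inj (inv \<pi>)"
    using assms by (simp_all add: bij_is_inj bij_imp_bij_inv)
  show "Poly_Mapping.map_key \<pi> (Poly_Mapping.map_key (inv \<pi>) p) = p"
    using assms inj by (intro poly_mapping_eqI) (simp add: map_key.rep_eq bij_is_inj)
  show "Poly_Mapping.map_key (inv \<pi>) (Poly_Mapping.map_key \<pi> q) = q"
    using assms inj by (intro poly_mapping_eqI) (simp add: map_key.rep_eq bij_is_surj surj_f_inv_f)
qed

lemma inj_map_key:
  assumes "bij \<pi>"
  shows "inj (Poly_Mapping.map_key \<pi> :: ('a \<Rightarrow>\<^sub>0 'b::zero) \<Rightarrow> _)"
  by (rule inj_on_inverseI[where g = "Poly_Mapping.map_key (inv \<pi>)"]) (simp add: map_key_inv assms)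

lemma relabel_add: "bij \<pi> \<Longrightarrow> relabel \<pi> (f + g) = relabel \<pi> f + relabel \<pi> g"
  by (simp add: relabel_def map_key_plus inj_map_key)

lemma relabel_single:
  assumes "bij \<pi>"
  shows "relabel \<pi> (Poly_Mapping.single \<alpha> c) = Poly_Mapping.single (Poly_Mapping.map_key (inv \<pi>) \<alpha>) c"
proof -
  have "relabel \<pi> (Poly_Mapping.single (Poly_Mapping.map_key \<pi> (Poly_Mapping.map_key (inv \<pi>) \<alpha>)) c)
     = Poly_Mapping.single (Poly_Mapping.map_key (inv \<pi>) \<alpha>) c"
    unfolding relabel_def by (rule map_key_single) (rule inj_map_key[OF assms])
  then show ?thesis by (simp add: map_key_inv assms)
qed

lemma mpol_induct [case_names zero single add]:
  fixes f :: mpol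
  assumes "P 0" "\<And>\<alpha> c. P (Poly_Mapping.single \<alpha> c)" "\<And>f g. P f \<Longrightarrow> P g \<Longrightarrow> P (f + g)"
  shows "P f"
proof (induction f rule: Poly_Mapping.update_induct)
  case const
  show ?case by (rule assms(1))
next
  case (update f a b)
  have "Poly_Mapping.update a b f = f + Poly_Mapping.single a b"
    using update(1) by (intro poly_mapping_eqI) (auto simp: lookup_update lookup_add lookup_single when_def not_in_keys_iff_lookup_eq_zero)
  then show ?case using assms(3)[OF update.IH assms(2), of a b] by simp
qed

lemma relabel_mult:
  assumes "bij \<pi>"
  shows "relabel \<pi> (f * g) = relabel \<pi> f * relabel \<pi> g"
proof (induction f rule: mpol_induct)
  case (single \<alpha> c)
  have "inj (inv \<pi>)" using assms by (simp add: bij_imp_bij_inv bij_is_inj)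
  note * = map_key_plus[OF this]
  show ?case
  proof (induction g rule: mpol_induct)
    case (single \<beta> d)
    show ?case by (simp add: mult_single relabel_single assms *)
  qed (simp_all add: relabel_def relabel_add[OF assms, unfolded relabel_def] distrib_left map_key_zero inj_map_key assms)
qed (simp_all add: relabel_def relabel_add[OF assms, unfolded relabel_def] distrib_right map_key_zero inj_map_key assms)

lemma relabel_X:
  assumes "bij \<pi>"
  shows "relabel \<pi> (X i) = X (\<pi> i)"
proof -
  have "Poly_Mapping.map_key (inv \<pi>) (Poly_Mapping.single (inv \<pi> (\<pi> i)) (1::nat)) = Poly_Mapping.single (\<pi> i) 1"
    using assms by (intro map_key_single) (simp add: bij_imp_bij_inv bij_is_inj)
  then show ?thesis using assms by (simp add: X_def relabel_single bij_is_inj)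
qed

lemma comm_ring_hom_relabel:
  assumes "bij \<pi>"
  shows "comm_ring_hom (relabel \<pi>)"
proof
  have "inj (inv \<pi>)" using assms by (simp add: bij_imp_bij_inv bij_is_inj)
  then have "relabel \<pi> (Poly_Mapping.single 0 1) = Poly_Mapping.single 0 1"
    by (subst relabel_single[OF assms]) (simp add: map_key_zero)
  then show "relabel \<pi> 1 = 1" by simp
qed (use assms in \<open>simp_all add: relabel_add relabel_mult\<close>)

lemma div_diff_sch:
  assumes "1 \<le> i" "i < N" "w i < w (Suc i)"
  shows "div_diff i (sch N X N (w \<circ> adj i)) = sch N X N w"
proof -
  have b: "bij (adj i)" by simp
  interpret comm_ring_hom "relabel (adj i)"
    by (rule comm_ring_hom_relabel) (rule b)
  have X: "relabel (adj i) \<circ> X = X \<circ> adj i"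
    using b by (simp add: fun_eq_iff relabel_X)
  have "swap_vars i (sch N X N v) = sch N (X \<circ> adj i) N v" for v
    using fun_cong[OF hom_sch[of N X N], of v] unfolding X by (simp only: swap_vars_def relabel_def o_apply)
  then have eq: "(X i - X (Suc i)) * sch N X N w = sch N X N (w \<circ> adj i) - swap_vars i (sch N X N (w \<circ> adj i))"
    using sch_div_diff[OF assms, of X] by simp
  \<comment> \<open>The divisor must be nonzero, so that it can be cancelled and the quotient is
    unique.\<close>
  have "(Poly_Mapping.single i 1 :: expo) \<noteq> Poly_Mapping.single (Suc i) 1"
    by (metis lookup_single_eq lookup_single_not_eq n_not_Suc_n zero_neq_one)
  then have ne: "X i \<noteq> X (Suc i)"
    unfolding X_def by (metis lookup_single_eq lookup_single_not_eq zero_neq_one)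
  show ?thesis
    unfolding div_diff_def eq[symmetric] by (rule the_equality) (use ne in auto)
qed

section \<open>Schubert polynomials as coefficients\<close>

definition bef :: "(nat \<Rightarrow> nat) \<Rightarrow> nat \<Rightarrow> nat set" where
  "bef w j = {l. j < l \<and> inv w l < inv w j}"

text \<open>
  This Lehmer code is indexed by values, not positions: undoing a descent lowers exactly one entry,
  that of the smaller of the two values exchanged.
\<close>

definition lcode :: "(nat \<Rightarrow> nat) \<Rightarrow> nat \<Rightarrow> nat" where
  "lcode w j = card (bef w j)"

text \<open>The number of inversions, that is, the Coxeter length.\<close>

definition len :: "nat \<Rightarrow> (nat \<Rightarrow> nat) \<Rightarrow> nat" where
  "len n w = (\<Sum>j=1..n. lcode w j)"

lemma finite_bef:
  assumes "bij w"
  shows "finite (bef w j)"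
proof (rule finite_subset)
  show "bef w j \<subseteq> w ` {..<inv w j}"
    using assms by (auto simp: bef_def bij_is_surj surj_f_inv_f intro!: image_eqI[where x = "inv w _"])
qed simp

text \<open>Only the relative order of the two exchanged values changes, and this pair is recorded
  at its smaller member.\<close>

lemma bef_comp_adj:
  assumes "bij w" "w (Suc m) < w m"
  shows "bef (w \<circ> adj m) j = (if j = w (Suc m) then bef w j - {w m} else bef w j)"
proof -
  have inv: "inv (w \<circ> adj m) = adj m \<circ> inv w"
    using assms(1) by (simp add: o_inv_distrib bij_is_inj)
  have inv_w: "inv w (w a) = a" and eq: "w a = w b \<longleftrightarrow> a = b" for a b
    using assms(1) by (simp_all add: bij_is_inj inj_eq)
  obtain q where q: "j = w q"
    using assms(1) by (metis bij_inv_eq_iff)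
  have "l \<in> bef (w \<circ> adj m) j \<longleftrightarrow> l \<in> (if j = w (Suc m) then bef w j - {w m} else bef w j)" for l
  proof -
    obtain p where p: "l = w p"
      using assms(1) by (metis bij_inv_eq_iff)
    show ?thesis
      using assms(2) by (auto simp: bef_def inv inv_w p q eq Transposition.transpose_def)
  qed
  then show ?thesis by blast
qed

lemma lcode_comp_adj:
  assumes "bij w" "w (Suc m) < w m"
  shows "lcode w j = lcode (w \<circ> adj m) j + (if j = w (Suc m) then 1 else 0)"
proof (cases "j = w (Suc m)")
  case True
  then have "w m \<in> bef w j"
    using assms by (simp add: bef_def bij_is_inj)
  then show ?thesis
    using True card.remove[OF finite_bef[OF assms(1)], of "w m" j]
    by (simp add: lcode_def bef_comp_adj[OF assms] del: comp_apply)
qed (simp add: lcode_def bef_comp_adj[OF assms] del: comp_apply)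

lemma permutes_comp_adj:
  "w permutes {1..n} \<Longrightarrow> 1 \<le> m \<Longrightarrow> m < n \<Longrightarrow> w \<circ> adj m permutes {1..n}"
  by (rule permutes_compose) (simp_all add: permutes_swap_id)

lemma len_comp_adj:
  assumes "w permutes {1..n}" "1 \<le> m" "m < n" "w (Suc m) < w m"
  shows "len n w = Suc (len n (w \<circ> adj m))"
proof -
  have "bij w" using assms(1) by (rule permutes_bij)
  moreover have "w (Suc m) \<in> {1..n}"
    using permutes_in_image[OF assms(1), of "Suc m"] assms by simp
  ultimately show ?thesis
    using assms by (simp add: len_def lcode_comp_adj[of w m] sum.distrib del: comp_apply)
qed

text \<open>A crude bound that turns climbing along ascents into a terminating induction.\<close>

lemma len_le:
  assumes "w permutes {1..n}"
  shows "len n w \<le> n * n"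
proof -
  have "lcode w j \<le> n" if "j \<in> {1..n}" for j
  proof -
    have "bef w j \<subseteq> {1..n}"
    proof
      fix l assume l: "l \<in> bef w j"
      show "l \<in> {1..n}"
      proof (rule ccontr)
        assume "l \<notin> {1..n}"
        then have "inv w l = l" using permutes_not_in[OF permutes_inv[OF assms]] by blast
        moreover have "inv w j \<in> {1..n}" using permutes_in_image[OF permutes_inv[OF assms]] that by blast
        ultimately show False using l \<open>l \<notin> {1..n}\<close> by (auto simp: bef_def)
      qed
    qed
    from card_mono[OF _ this] show ?thesis by (simp add: lcode_def)
  qed
  then have "len n w \<le> (\<Sum>j=1..n. n)" unfolding len_def by (intro sum_mono)
  then show ?thesis by simp
qed

lemma increasing_eq_id:
  fixes v :: "nat \<Rightarrow> nat"
  assumes "\<And>i. i \<in> {1..n} \<Longrightarrow> v i \<in> {1..n}" "\<And>i. 1 \<le> i \<Longrightarrow> i < n \<Longrightarrow> v i < v (Suc i)"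
    and "i \<in> {1..n}"
  shows "v i = i"
proof (rule antisym)
  have "1 \<le> i" "i \<le> n" using assms(3) by auto
  from \<open>1 \<le> i\<close> have "i \<le> n \<Longrightarrow> i \<le> v i"
  proof (induction i rule: dec_induct)
    case base
    then show ?case using assms(1)[of 1] by simp
  next
    case (step i)
    then show ?case using assms(2)[of i] by simp
  qed
  then show "i \<le> v i" using \<open>i \<le> n\<close> by simp
  from \<open>i \<le> n\<close> have "1 \<le> i \<Longrightarrow> v i \<le> i"
  proof (induction i rule: inc_induct)
    case base
    then show ?case using assms(1)[of n] by simp
  next
    case (step i)
    then show ?case using assms(2)[of i] by simp
  qed
  then show "v i \<le> i" using \<open>1 \<le> i\<close> by simp
qed

lemma eq_longest:
  assumes "w permutes {1..n}" "\<And>i. 1 \<le> i \<Longrightarrow> i < n \<Longrightarrow> \<not> w i < w (Suc i)"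
  shows "w = longest n"
proof
  fix i
  have w: "w j \<in> {1..n} \<longleftrightarrow> j \<in> {1..n}" for j
    using assms(1) by (rule permutes_in_image)
  have dec: "w (Suc j) < w j" if "1 \<le> j" "j < n" for j
    using assms(2)[OF that] permutes_inj[OF assms(1)] by (metis inj_eq linorder_neqE_nat n_not_Suc_n)
  show "w i = longest n i"
  proof (cases "i \<in> {1..n}")
    case True
    \<comment> \<open>Reversing the values turns the decreasing sequence into an increasing
      one.\<close>
    have "Suc n - w i = i"
    proof (rule increasing_eq_id[OF _ _ True])
      show "Suc n - w i \<in> {1..n}" if "i \<in> {1..n}" for i
        using w[of i] that by auto
      show "Suc n - w i < Suc n - w (Suc i)" if "1 \<le> i" "i < n" for i
        using dec[OF that] w[of i] that by auto
    qed
    then show ?thesis using True w[of i] by (auto simp: longest_def)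
  next
    case False
    then show ?thesis using permutes_not_in[OF assms(1)] by (auto simp: longest_def)
  qed
qed

section \<open>Length bounds and the longest permutation\<close>

text \<open>Each factor shortens the argument by at most one, so \<open>\<phi>\<close> is only
  evaluated at permutations longer than \<open>L\<close>.\<close>

lemma nilrun_vanish:
  assumes "w permutes {1..n}" "1 \<le> m" "m + k \<le> n" "L + k < len n w"
    and "\<And>v. v permutes {1..n} \<Longrightarrow> L < len n v \<Longrightarrow> \<phi> v = 0"
  shows "nilrun m k x \<phi> w = 0"
  using assms(1-4)
proof (induction k arbitrary: m w)
  case (Suc k)
  have "nilrun (Suc m) k x \<phi> (w \<circ> adj m) = 0" if "w (Suc m) < w m"
    using Suc.prems len_comp_adj[of w n m] that
    by (intro Suc.IH permutes_comp_adj) (auto simp del: comp_apply)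
  then show ?case using Suc.prems Suc.IH[of w "Suc m"] by (simp add: nilh_def)
qed (simp add: assms(5))

text \<open>The effect of a run in which all \<open>k\<close> exchanges take place: the entry at
  \<open>m\<close> travels to \<open>m + k\<close>.\<close>

definition rot :: "nat \<Rightarrow> nat \<Rightarrow> (nat \<Rightarrow> nat) \<Rightarrow> nat \<Rightarrow> nat" where
  "rot m k w i = (if m \<le> i \<and> i < m + k then w (Suc i) else if i = m + k then w m else w i)"

lemma rot_0 [simp]: "rot m 0 w = w"
  by (auto simp: rot_def)

lemma rot_Suc: "rot m (Suc k) w = rot (Suc m) k (w \<circ> adj m)"
  by (auto simp: fun_eq_iff rot_def Transposition.transpose_def)

lemma len_rot:
  assumes "w permutes {1..n}" "1 \<le> m" "m + k \<le> n" "\<forall>i\<in>{m<..m+k}. w i < w m"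
  shows "len n w = len n (rot m k w) + k"
  using assms
proof (induction k arbitrary: m w)
  case (Suc k)
  have "len n w = Suc (len n (w \<circ> adj m))"
    using Suc.prems by (intro len_comp_adj) auto
  also have "len n (w \<circ> adj m) = len n (rot (Suc m) k (w \<circ> adj m)) + k"
    using Suc.prems by (intro Suc.IH permutes_comp_adj) (auto simp: Transposition.transpose_def)
  finally show ?case by (simp add: rot_Suc)
qed simp

text \<open>At the extreme length every factor has to contribute its exchange; skipping one leaves
  an argument on which \<open>nilrun_vanish\<close> applies.\<close>

lemma nilrun_top:
  assumes "w permutes {1..n}" "1 \<le> m" "m + k \<le> n" "\<forall>i\<in>{m<..m+k}. w i < w m" "len n w = L + k"
    and "\<And>v. v permutes {1..n} \<Longrightarrow> L < len n v \<Longrightarrow> \<phi> v = 0"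
  shows "nilrun m k x \<phi> w = x ^ k * \<phi> (rot m k w)"
  using assms(1-5)
proof (induction k arbitrary: m w)
  case (Suc k)
  have "len n w = Suc (len n (w \<circ> adj m))"
    using Suc.prems by (intro len_comp_adj) auto
  then have len: "len n (w \<circ> adj m) = L + k" using Suc.prems by simp
  have "nilrun (Suc m) k x \<phi> (w \<circ> adj m) = x ^ k * \<phi> (rot (Suc m) k (w \<circ> adj m))"
    using Suc.prems by (intro Suc.IH permutes_comp_adj len) (auto simp: Transposition.transpose_def)
  moreover have "nilrun (Suc m) k x \<phi> w = 0"
    using Suc.prems by (intro nilrun_vanish[OF _ _ _ _ assms(6)]) auto
  ultimately show ?case using Suc.prems by (simp add: nilh_def rot_Suc mult.assoc)
qed simp

text \<open>The permutations \<open>n, n-1, \<dots>, n-j+1, 1, 2, \<dots>, n-j\<close>, which lead from the identity to \<^const>\<open>longest\<close>.\<close>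

definition stair :: "nat \<Rightarrow> nat \<Rightarrow> nat \<Rightarrow> nat" where
  "stair n j i = (if 1 \<le> i \<and> i \<le> j then Suc n - i else if j < i \<and> i \<le> n then i - j else i)"

lemma stair_permutes: "j \<le> n \<Longrightarrow> stair n j permutes {1..n}"
proof (rule bij_imp_permutes)
  assume "j \<le> n"
  then have inj: "inj_on (stair n j) {1..n}"
    by (auto simp: inj_on_def stair_def split: if_splits)
  have "stair n j ` {1..n} \<subseteq> {1..n}"
    using \<open>j \<le> n\<close> by (auto simp: stair_def)
  then show "bij_betw (stair n j) {1..n} {1..n}"
    using inj by (simp add: bij_betw_def endo_inj_surj)
qed (auto simp: stair_def)

lemma rot_stair:
  assumes "j < n"
  shows "rot (Suc j) (n - Suc j) (stair n (Suc j)) = stair n j"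
  using assms by (auto simp: fun_eq_iff rot_def stair_def)

text \<open>The two claims go together: vanishing above the length of one stair isolates a single
  term at the next stair.\<close>

lemma sch_stair:
  assumes "j \<le> n"
  shows "sch n z j (stair n j) = (\<Prod>i=1..j. z i ^ (n - i))"
    "v permutes {1..n} \<Longrightarrow> len n (stair n j) < len n v \<Longrightarrow> sch n z j v = 0"
  using assms
proof (induction j arbitrary: v)
  case 0
  case 1
  show ?case by (simp add: delta_def stair_def)
next
  case 0
  case 2
  have "v = stair n 0" if "\<forall>i\<ge>1. v i = i"
  proof
    fix i show "v i = stair n 0 i"
      using that permutes_not_in[OF 2(1), of 0] by (cases "i = 0") (auto simp: stair_def)
  qed
  then show ?case using 2 by (auto simp: delta_def)
next
  case (Suc j)
  case 1
  have desc: "\<forall>i\<in>{Suc j<..Suc j + (n - Suc j)}. stair n (Suc j) i < stair n (Suc j) (Suc j)"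
    using 1 by (auto simp: stair_def)
  have len: "len n (stair n (Suc j)) = len n (stair n j) + (n - Suc j)"
    using len_rot[OF stair_permutes[of "Suc j" n] _ _ desc] 1 by (simp add: rot_stair)
  have "sch n z (Suc j) (stair n (Suc j)) = z (Suc j) ^ (n - Suc j) * sch n z j (stair n j)"
    using 1 Suc nilrun_top[OF stair_permutes[of "Suc j" n] _ _ desc len, of "sch n z j" "z (Suc j)"]
    by (simp add: rot_stair)
  then show ?case using Suc(1) 1 by (simp add: mult.commute)
next
  case (Suc j)
  case 2
  have desc: "\<forall>i\<in>{Suc j<..Suc j + (n - Suc j)}. stair n (Suc j) i < stair n (Suc j) (Suc j)"
    using 2 by (auto simp: stair_def)
  have len: "len n (stair n (Suc j)) = len n (stair n j) + (n - Suc j)"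
    using len_rot[OF stair_permutes[of "Suc j" n] _ _ desc] 2 by (simp add: rot_stair)
  show ?case
    using 2 Suc len by (auto intro!: nilrun_vanish[where L = "len n (stair n j)"])
qed

lemma sch_longest: "sch n z n (longest n) = (\<Prod>i=1..n. z i ^ (n - i))"
proof -
  have "stair n n = longest n"
    by (auto simp: fun_eq_iff stair_def longest_def)
  then show ?thesis using sch_stair(1)[of n n z] by simp
qed

section \<open>Existence and uniqueness of Schubert polynomials\<close>

lemma is_schubert_unique: "is_schubert n w f \<Longrightarrow> f = sch n X n w"
  by (induction rule: is_schubert.induct) (simp_all add: sch_longest div_diff_sch del: comp_apply)

text \<open>Every ascent leads to a longer permutation, and the climb can only stop at
  \<open>longest n\<close>.\<close>

lemma is_schubert_sch:
  assumes "w permutes {1..n}"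
  shows "is_schubert n w (sch n X n w)"
  using assms
proof (induction "n * n - len n w" arbitrary: w rule: less_induct)
  case less
  show ?case
  proof (cases "\<exists>i\<ge>1. i < n \<and> w i < w (Suc i)")
    case True
    then obtain i where i: "1 \<le> i" "i < n" "w i < w (Suc i)" by blast
    let ?v = "w \<circ> adj i"
    have v: "?v permutes {1..n}" using less.prems i by (intro permutes_comp_adj)
    have "len n ?v = Suc (len n w)"
      using len_comp_adj[OF v i(1,2)] i(3) by (simp add: comp_assoc)
    then have "is_schubert n ?v (sch n X n ?v)"
      using len_le[OF v] by (intro less.hyps v) simp
    then show ?thesis
      using is_schubert.ascent[OF less.prems i] div_diff_sch[OF i] by metis
  next
    case False
    then have "w = longest n" using less.prems by (intro eq_longest) auto
    then show ?thesis using is_schubert.longest[of n] by (simp add: sch_longest)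
  qed
qed

lemma schubert_eq_sch: "w permutes {1..n} \<Longrightarrow> schubert n w = sch n X n w"
  unfolding schubert_def
  by (rule the_equality) (simp_all add: is_schubert_sch is_schubert_unique)

section \<open>Stability and symmetry\<close>

text \<open>Subtraction of exponents is truncated, hence the guard.\<close>

lemma lookup_X_mult:
  "Poly_Mapping.lookup (X i * f) \<alpha> =
    (if 0 < Poly_Mapping.lookup \<alpha> i then Poly_Mapping.lookup f (\<alpha> - Poly_Mapping.single i 1) else 0)"
proof (induction f rule: mpol_induct)
  case (single \<beta> d)
  have "\<alpha> = Poly_Mapping.single i 1 + \<beta> \<longleftrightarrow> 0 < Poly_Mapping.lookup \<alpha> i \<and> \<alpha> - Poly_Mapping.single i 1 = \<beta>"
    by (auto simp: poly_mapping_eq_iff fun_eq_iff lookup_add lookup_minus lookup_single when_def)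
  then show ?case
    by (auto simp: X_def mult_single lookup_single when_def)
qed (simp_all add: distrib_left lookup_add)

text \<open>On monomials free of \<open>X i\<close> the run acts as if this variable were
  zero.\<close>

lemma lookup_nilrun_absent:
  assumes "Poly_Mapping.lookup \<alpha> i = 0"
  shows "Poly_Mapping.lookup (nilrun m k (X i) \<phi> w) \<alpha> = Poly_Mapping.lookup (\<phi> w) \<alpha>"
  by (induction k arbitrary: m w) (simp_all add: nilh_def lookup_add lookup_X_mult assms)

lemma keys_nilrun:
  assumes "\<And>w \<alpha>. Poly_Mapping.lookup (\<phi> w) \<alpha> \<noteq> 0 \<Longrightarrow> Poly_Mapping.keys \<alpha> \<subseteq> S"
    and "Poly_Mapping.lookup (nilrun m k (X i) \<phi> w) \<alpha> \<noteq> 0"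
  shows "Poly_Mapping.keys \<alpha> \<subseteq> insert i S"
  using assms(2)
proof (induction k arbitrary: m w \<alpha>)
  case 0
  then have "Poly_Mapping.lookup (\<phi> w) \<alpha> \<noteq> 0" by simp
  from assms(1)[OF this] show ?case by blast
next
  case (Suc k)
  let ?\<psi> = "nilrun (Suc m) k (X i) \<phi>" and ?\<beta> = "\<alpha> - Poly_Mapping.single i 1"
  have "Poly_Mapping.lookup (?\<psi> w) \<alpha> \<noteq> 0 \<or> Poly_Mapping.lookup (?\<psi> (w \<circ> adj m)) ?\<beta> \<noteq> 0"
  proof (rule ccontr)
    assume "\<not> ?thesis"
    then show False using Suc.prems by (simp add: nilh_def lookup_add lookup_X_mult split: if_splits)
  qed
  then show ?case
  proof
    assume "Poly_Mapping.lookup (?\<psi> (w \<circ> adj m)) ?\<beta> \<noteq> 0"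
    then have "Poly_Mapping.keys ?\<beta> \<subseteq> insert i S" by (rule Suc.IH)
    moreover have "Poly_Mapping.keys \<alpha> \<subseteq> insert i (Poly_Mapping.keys ?\<beta>)"
      by (auto simp: in_keys_iff lookup_minus lookup_single when_def split: if_splits)
    ultimately show ?thesis by blast
  qed (rule Suc.IH)
qed

text \<open>
  The Stanley symmetric function in the variables indexed by \<open>S\<close>. The fold is meaningful because
  the factors commute.
\<close>

definition stan :: "nat \<Rightarrow> nat set \<Rightarrow> (nat \<Rightarrow> nat) \<Rightarrow> mpol" where
  "stan n S = Finite_Set.fold (\<lambda>i. nilrun 1 (n - 1) (X i)) delta S"

lemma stan_empty [simp]: "stan n {} = delta"
  by (simp add: stan_def)

lemma stan_insert:
  assumes "finite S" "i \<notin> S"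
  shows "stan n (insert i S) = nilrun 1 (n - 1) (X i) (stan n S)"
proof -
  interpret comp_fun_commute "\<lambda>i. nilrun 1 (n - 1) (X i)"
    by unfold_locales (simp add: fun_eq_iff nilrun_commute)
  show ?thesis unfolding stan_def by (rule fold_insert[OF assms])
qed

lemma keys_stan:
  assumes "finite S" "Poly_Mapping.lookup (stan n S w) \<alpha> \<noteq> 0"
  shows "Poly_Mapping.keys \<alpha> \<subseteq> S"
  using assms
proof (induction S arbitrary: w \<alpha>)
  case empty
  then show ?case by (auto simp: delta_def lookup_one when_def split: if_splits)
next
  case (insert i S)
  have "Poly_Mapping.lookup (nilrun 1 (n - 1) (X i) (stan n S) w) \<alpha> \<noteq> 0"
    using insert.prems(1) unfolding stan_insert[OF insert.hyps] .
  with insert.IH show ?case by (rule keys_nilrun)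
qed

lemma lookup_stan_Un:
  assumes "finite R" "finite S" "R \<inter> Poly_Mapping.keys \<alpha> \<subseteq> S"
  shows "Poly_Mapping.lookup (stan n (S \<union> R) w) \<alpha> = Poly_Mapping.lookup (stan n S w) \<alpha>"
  using assms(1,3)
proof (induction R)
  case (insert i R)
  then have IH: "Poly_Mapping.lookup (stan n (S \<union> R) w) \<alpha> = Poly_Mapping.lookup (stan n S w) \<alpha>"
    by blast
  show ?case
  proof (cases "i \<in> S")
    case True
    then have "S \<union> insert i R = S \<union> R" by auto
    then show ?thesis using IH by simp
  next
    case False
    then have "Poly_Mapping.lookup \<alpha> i = 0" using insert by (auto simp: in_keys_iff)
    then show ?thesis using insert.hyps IH False assms(2) by (simp add: stan_insert lookup_nilrun_absent)
  qed
qed simp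

text \<open>Commutation pays off here: the fold depends on the set of variables only, not on their
  order.\<close>

lemma relabel_stan:
  assumes "bij \<pi>" "finite S"
  shows "relabel \<pi> \<circ> stan n S = stan n (\<pi> ` S)"
  using assms(2)
proof (induction S)
  interpret comm_ring_hom "relabel \<pi>"
    by (rule comm_ring_hom_relabel) (rule assms)
  case empty
  show ?case by (simp add: hom_delta)
  case (insert i S)
  have "\<pi> i \<notin> \<pi> ` S" using insert assms(1) by (simp add: bij_is_inj inj_image_mem_iff)
  then show ?case
    unfolding stan_insert[OF insert.hyps] hom_nilrun insert.IH
    using insert.hyps assms(1) by (simp add: stan_insert relabel_X)
qed

section \<open>Stability under the shift by t\<close>

text \<open>The shifted permutation has no descent at positions up to \<open>t\<close>, so the
  generators there do nothing.\<close>

lemma nilrun_shift_skip: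
  "m + d \<le> Suc t \<Longrightarrow> nilrun m (d + k) x \<phi> (shift_perm t w) = nilrun (m + d) k x \<phi> (shift_perm t w)"
proof (induction d arbitrary: m)
  case (Suc d)
  have "\<not> shift_perm t w (Suc m) < shift_perm t w m"
    using Suc.prems by (auto simp: shift_perm_def)
  then show ?case using Suc by (simp add: nilh_def)
qed simp

lemma nilrun_shift:
  "1 \<le> m \<Longrightarrow> nilrun (t + m) k x \<phi> (shift_perm t w) = nilrun m k x (\<phi> \<circ> shift_perm t) w"
proof (induction k arbitrary: m w)
  case (Suc k)
  have "shift_perm t w \<circ> adj (t + m) = shift_perm t (w \<circ> adj m)"
    using Suc.prems by (auto simp: fun_eq_iff shift_perm_def Transposition.transpose_def)
  moreover have "shift_perm t w (Suc (t + m)) < shift_perm t w (t + m) \<longleftrightarrow> w (Suc m) < w m"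
    using Suc.prems by (auto simp: shift_perm_def)
  ultimately show ?case using Suc.IH[of "Suc m"] by (simp add: nilh_def)
qed simp

text \<open>Of the generators in each run, those up to \<open>t\<close> are skipped and the
  remaining n-1 act like u_1, ..., u_(n-1) on \<open>w\<close>. Thus runs of varying length become
  equal full runs.\<close>

lemma sch_shift:
  "j \<le> t \<Longrightarrow> n \<ge> 1 \<Longrightarrow> sch (t + n) X j (shift_perm t w) = stan n {1..j} w"
proof (induction j arbitrary: w)
  case 0
  have "(\<forall>i\<ge>1. shift_perm t w i = i) \<longleftrightarrow> (\<forall>i\<ge>1. w i = i)"
  proof (intro iffI allI impI)
    fix i :: nat assume *: "\<forall>i\<ge>1. shift_perm t w i = i" "i \<ge> 1"
    then show "w i = i" using *(1)[rule_format, of "t + i"] by (simp add: shift_perm_def)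
  qed (auto simp: shift_perm_def)
  then show ?case by (simp add: delta_def)
next
  case (Suc j)
  have N: "t + n - Suc j = (t - j) + (n - 1)" using Suc by simp
  have "sch (t + n) X (Suc j) (shift_perm t w) = nilrun (t + 1) (n - 1) (X (Suc j)) (sch (t + n) X j) (shift_perm t w)"
    unfolding sch.simps N using Suc.prems by (subst nilrun_shift_skip) simp_all
  also have "\<dots> = nilrun 1 (n - 1) (X (Suc j)) (sch (t + n) X j \<circ> shift_perm t) w"
    by (rule nilrun_shift) simp
  also have "sch (t + n) X j \<circ> shift_perm t = stan n {1..j}"
    using Suc by (auto simp: fun_eq_iff)
  also have "nilrun 1 (n - 1) (X (Suc j)) (stan n {1..j}) = stan n {1..Suc j}"
    by (subst stan_insert[symmetric]) (simp_all add: atLeastAtMostSuc_conv)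
  finally show ?case .
qed

lemma lookup_sch_drop:
  assumes "t \<le> j" "\<And>i. t < i \<Longrightarrow> Poly_Mapping.lookup \<alpha> i = 0"
  shows "Poly_Mapping.lookup (sch N X j u) \<alpha> = Poly_Mapping.lookup (sch N X t u) \<alpha>"
  using assms(1) by (induction j rule: dec_induct) (simp_all add: lookup_nilrun_absent assms(2))

lemma shift_perm_permutes:
  assumes "w permutes {1..n}"
  shows "shift_perm t w permutes {1..t + n}"
proof (rule bij_imp_permutes)
  have w: "w i \<in> {1..n} \<longleftrightarrow> i \<in> {1..n}" for i
    by (rule permutes_in_image[OF assms])
  have w': "1 \<le> w i" "w i \<le> n" if "1 \<le> i" "i \<le> n" for i
    using w[of i] that by auto
  have "inj_on (shift_perm t w) {1..t + n}"
  proof (rule linorder_inj_onI)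
    fix x y assume xy: "x < y" "x \<in> {1..t + n}" "y \<in> {1..t + n}"
    have "w (x - t) \<noteq> w (y - t)" if "t < x"
      using permutes_inj[OF assms] xy that by (auto dest!: injD)
    moreover have "1 \<le> w (y - t)" if "t < y" using w'[of "y - t"] xy that by simp
    ultimately show "shift_perm t w x \<noteq> shift_perm t w y"
      using xy by (auto simp: shift_perm_def)
  qed auto
  moreover have "shift_perm t w ` {1..t + n} \<subseteq> {1..t + n}"
  proof
    fix y assume "y \<in> shift_perm t w ` {1..t + n}"
    then obtain x where "x \<in> {1..t + n}" "y = shift_perm t w x" by blast
    then show "y \<in> {1..t + n}"
      using w'[of "x - t"] by (cases "x \<le> t") (auto simp: shift_perm_def not_le Suc_le_eq)
  qed
  ultimately show "bij_betw (shift_perm t w) {1..t + n} {1..t + n}"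
    by (simp add: bij_betw_def endo_inj_surj)
  show "shift_perm t w x = x" if "x \<notin> {1..t + n}" for x
  proof (cases "x \<le> t")
    case False
    with that have "x - t \<notin> {1..n}" by auto
    then show ?thesis using permutes_not_in[OF assms] False by (simp add: shift_perm_def)
  qed (simp add: shift_perm_def)
qed

text \<open>The sequence is constant once \<open>t\<close> bounds \<open>S\<close>. The exponent may
  involve index 0: no variable of the product has this number, so both sides are then zero, which is
  how \<open>stanley_keys\<close> excludes it.\<close>

lemma stanley_eq_stan:
  assumes "n \<ge> 1" "w permutes {1..n}" "finite S" "0 \<notin> S" "Poly_Mapping.keys \<alpha> \<subseteq> insert 0 S"
  shows "stanley n w \<alpha> = Poly_Mapping.lookup (stan n S w) \<alpha>"
proof -
  obtain M where M: "\<forall>i\<in>S. i \<le> M" using assms(3) finite_nat_set_iff_bounded_le by auto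
  have "Poly_Mapping.lookup (schubert (t + n) (shift_perm t w)) \<alpha> = Poly_Mapping.lookup (stan n S w) \<alpha>" if "t \<ge> M" for t
  proof -
    have "S \<subseteq> {1..t}"
    proof
      fix i assume "i \<in> S"
      then show "i \<in> {1..t}" using M assms(4) that by (cases "i = 0") force+
    qed
    then have eq: "S \<union> {1..t} = {1..t}" by blast
    have "Poly_Mapping.lookup \<alpha> i = 0" if "t < i" for i
      using that M \<open>t \<ge> M\<close> assms(5) by (fastforce simp: in_keys_iff)
    then have "Poly_Mapping.lookup (schubert (t + n) (shift_perm t w)) \<alpha>
        = Poly_Mapping.lookup (sch (t + n) X t (shift_perm t w)) \<alpha>"
      by (subst schubert_eq_sch[OF shift_perm_permutes[OF assms(2)]]) (simp add: lookup_sch_drop)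
    also have "\<dots> = Poly_Mapping.lookup (stan n (S \<union> {1..t}) w) \<alpha>"
      unfolding eq using assms(1) by (simp add: sch_shift)
    also have "\<dots> = Poly_Mapping.lookup (stan n S w) \<alpha>"
      using assms by (intro lookup_stan_Un) auto
    finally show ?thesis .
  qed
  then have "(\<lambda>t. Poly_Mapping.lookup (schubert (t + n) (shift_perm t w)) \<alpha>) \<longlonglongrightarrow> Poly_Mapping.lookup (stan n S w) \<alpha>"
    by (intro tendsto_eventually eventually_sequentiallyI)
  then show ?thesis unfolding stanley_def by (rule limI)
qed

lemma stanley_keys:
  assumes "n \<ge> 1" "w permutes {1..n}" "stanley n w \<alpha> \<noteq> 0"
  shows "Poly_Mapping.keys \<alpha> \<subseteq> {1..}"
proof -
  have "Poly_Mapping.lookup (stan n (Poly_Mapping.keys \<alpha> - {0}) w) \<alpha> \<noteq> 0"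
    using stanley_eq_stan[OF assms(1,2), of "Poly_Mapping.keys \<alpha> - {0}" \<alpha>] assms(3) by (simp add: insert_Diff_if subset_iff)
  from keys_stan[OF _ this] show ?thesis by (auto simp: Suc_le_eq subset_iff)
qed

text \<open>Renaming only changes the set of variables, and any set covering the exponent gives the
  same coefficient.\<close>

lemma stanley_symmetric:
  assumes "n \<ge> 1" "w permutes {1..n}" "\<pi> permutes {1..}"
  shows "stanley n w (Poly_Mapping.map_key \<pi> \<alpha>) = stanley n w \<alpha>"
proof -
  have bij: "bij \<pi>" and inj: "inj \<pi>" using assms(3) by (simp_all add: permutes_bij permutes_inj)
  have "\<pi> 0 = 0" using assms(3) by (simp add: permutes_not_in)
  then have zero_iff: "\<pi> i = 0 \<longleftrightarrow> i = 0" for i using inj_eq[OF inj, of i 0] by simp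
  define S where "S = Poly_Mapping.keys \<alpha> - {0}"
  have S: "finite (\<pi> -` S)" "0 \<notin> \<pi> -` S" "\<pi> ` (\<pi> -` S) = S"
    by (rule finite_vimageI[OF _ inj], simp add: S_def, simp add: S_def zero_iff, rule surj_image_vimage_eq[OF bij_is_surj[OF bij]])
  have "stanley n w \<alpha> = Poly_Mapping.lookup (stan n S w) \<alpha>"
    by (rule stanley_eq_stan) (use assms in \<open>auto simp: S_def\<close>)
  also have "stan n S = relabel \<pi> \<circ> stan n (\<pi> -` S)"
    using relabel_stan[OF bij S(1)] unfolding S(3) by (rule sym)
  also have "Poly_Mapping.lookup ((relabel \<pi> \<circ> stan n (\<pi> -` S)) w) \<alpha>
      = Poly_Mapping.lookup (stan n (\<pi> -` S) w) (Poly_Mapping.map_key \<pi> \<alpha>)"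
    unfolding relabel_def o_apply by (subst map_key.rep_eq[OF inj_map_key[OF bij]]) simp
  also have "\<dots> = stanley n w (Poly_Mapping.map_key \<pi> \<alpha>)"
    by (rule stanley_eq_stan[symmetric, OF assms(1,2) S(1,2)])
      (auto simp: S_def keys_map_key[OF inj] zero_iff)
  finally show ?thesis ..
qed

lemma restrict_vars_stanley:
  assumes "n \<ge> 1" "w permutes {1..n}"
  shows "restrict_vars m (stanley n w) = stan n {1..m} w"
proof -
  have "(stanley n w \<alpha> when Poly_Mapping.keys \<alpha> \<subseteq> {1..m}) = Poly_Mapping.lookup (stan n {1..m} w) \<alpha>" for \<alpha>
    using stanley_eq_stan[OF assms, of "{1..m}" \<alpha>] keys_stan[of "{1..m}" n w \<alpha>]
    by (auto simp: when_def)
  then show ?thesis by (simp add: restrict_vars_def lookup_inverse)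
qed

section \<open>The support of the Stanley symmetric function\<close>

text \<open>
  One bubble sort pass over the positions \<open>m, \<dots>, m + k\<close> in which descents may be left alone; it
  turns \<open>w\<close> into \<open>v\<close> with \<open>c\<close> exchanges.
\<close>

fun pass :: "nat \<Rightarrow> nat \<Rightarrow> (nat \<Rightarrow> nat) \<Rightarrow> nat \<Rightarrow> (nat \<Rightarrow> nat) \<Rightarrow> bool" where
  "pass m 0 w c v \<longleftrightarrow> c = 0 \<and> v = w"
| "pass m (Suc k) w c v \<longleftrightarrow> pass (Suc m) k w c v \<or>
    w (Suc m) < w m \<and> (\<exists>d. c = Suc d \<and> pass (Suc m) k (w \<circ> adj m) d v)"

lemma update_0_minus_single:
  "Poly_Mapping.update i 0 (\<alpha> - Poly_Mapping.single i 1) = Poly_Mapping.update i 0 (\<alpha> :: expo)"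
  by (rule poly_mapping_eqI) (simp add: lookup_update lookup_minus lookup_single when_def)

lemma lookup_nilrun_nonneg:
  assumes "\<And>w \<alpha>. 0 \<le> Poly_Mapping.lookup (\<phi> w) \<alpha>"
  shows "0 \<le> Poly_Mapping.lookup (nilrun m k (X i) \<phi> w) \<alpha>"
  by (induction k arbitrary: m w \<alpha>) (auto simp: nilh_def lookup_add lookup_X_mult assms)

text \<open>Nonnegativity rules out cancellation. As \<open>\<phi>\<close> is free of
  \<open>X i\<close>, the exponent of \<open>X i\<close> counts the exchanges of this pass
  alone.\<close>

lemma lookup_nilrun_pos_iff:
  assumes "\<And>w \<alpha>. 0 \<le> Poly_Mapping.lookup (\<phi> w) \<alpha>"
    and "\<And>w \<alpha>. 0 < Poly_Mapping.lookup (\<phi> w) \<alpha> \<Longrightarrow> Poly_Mapping.lookup \<alpha> i = 0"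
  shows "0 < Poly_Mapping.lookup (nilrun m k (X i) \<phi> w) \<alpha> \<longleftrightarrow>
    (\<exists>v. pass m k w (Poly_Mapping.lookup \<alpha> i) v \<and> 0 < Poly_Mapping.lookup (\<phi> v) (Poly_Mapping.update i 0 \<alpha>))"
proof (induction k arbitrary: m w \<alpha>)
  case 0
  have "Poly_Mapping.update i 0 \<alpha> = \<alpha>" if "Poly_Mapping.lookup \<alpha> i = 0"
    using that by (intro poly_mapping_eqI) (auto simp: lookup_update)
  then show ?case using assms(2)[of w \<alpha>] by auto
next
  case (Suc k)
  let ?\<psi> = "nilrun (Suc m) k (X i) \<phi>" and ?\<beta> = "\<alpha> - Poly_Mapping.single i 1"
  have sum_pos: "0 < a + b \<longleftrightarrow> 0 < a \<or> 0 < b" if "0 \<le> a" "0 \<le> b" for a b :: int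
    using that by linarith
  have "0 < Poly_Mapping.lookup (nilrun m (Suc k) (X i) \<phi> w) \<alpha> \<longleftrightarrow>
      0 < Poly_Mapping.lookup (?\<psi> w) \<alpha> \<or>
      w (Suc m) < w m \<and> 0 < Poly_Mapping.lookup \<alpha> i \<and> 0 < Poly_Mapping.lookup (?\<psi> (w \<circ> adj m)) ?\<beta>"
    by (simp add: nilh_def lookup_add lookup_X_mult sum_pos lookup_nilrun_nonneg assms(1) del: comp_apply)
  also have "\<dots> \<longleftrightarrow> (\<exists>v. pass m (Suc k) w (Poly_Mapping.lookup \<alpha> i) v
      \<and> 0 < Poly_Mapping.lookup (\<phi> v) (Poly_Mapping.update i 0 \<alpha>))"
    unfolding Suc.IH update_0_minus_single
    by (cases "Poly_Mapping.lookup \<alpha> i") (auto simp: lookup_minus simp del: comp_apply)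
  finally show ?case .
qed

lemma stan_nonneg:
  assumes "finite S"
  shows "0 \<le> Poly_Mapping.lookup (stan n S w) \<alpha>"
  using assms
proof (induction S arbitrary: w \<alpha>)
  case (insert i S)
  show ?case unfolding stan_insert[OF insert.hyps] by (rule lookup_nilrun_nonneg) (rule insert.IH)
qed (simp add: delta_def lookup_one when_def)

lemma stan_Suc_pos_iff:
  "0 < Poly_Mapping.lookup (stan n {1..Suc m} w) \<alpha> \<longleftrightarrow>
    (\<exists>v. pass 1 (n - 1) w (Poly_Mapping.lookup \<alpha> (Suc m)) v
      \<and> 0 < Poly_Mapping.lookup (stan n {1..m} v) (Poly_Mapping.update (Suc m) 0 \<alpha>))"
proof -
  have S: "{1..Suc m} = insert (Suc m) {1..m}" by auto
  have absent: "Poly_Mapping.lookup \<beta> (Suc m) = 0" if "0 < Poly_Mapping.lookup (stan n {1..m} u) \<beta>" for u \<beta>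
  proof -
    have "Poly_Mapping.keys \<beta> \<subseteq> {1..m}" using that by (intro keys_stan[of _ n u]) auto
    then have "Suc m \<notin> Poly_Mapping.keys \<beta>" by auto
    then show ?thesis by (simp add: in_keys_iff)
  qed
  have "stan n {1..Suc m} = nilrun 1 (n - 1) (X (Suc m)) (stan n {1..m})"
    unfolding S by (rule stan_insert) auto
  then show ?thesis
    using lookup_nilrun_pos_iff[of "stan n {1..m}" "Suc m" 1 "n - 1" w \<alpha>, OF stan_nonneg[OF finite_atLeastAtMost] absent]
    by simp
qed

text \<open>\<open>J\<close> collects the values overtaken by a larger one carried to the right;
  each of them loses one larger value on its left.\<close>

lemma pass_lcode:
  assumes "pass m k w c v" "w permutes {1..n}" "1 \<le> m" "m + k \<le> n"
  shows "v permutes {1..n} \<and> (\<exists>J \<subseteq> w ` {m<..m + k}. card J = c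
    \<and> (\<forall>j. lcode w j = lcode v j + (if j \<in> J then 1 else 0)))"
  using assms
proof (induction k arbitrary: m w c)
  case 0
  then show ?case by auto
next
  case (Suc k)
  show ?case
  proof (cases "pass (Suc m) k w c v")
    case True
    have "v permutes {1..n} \<and> (\<exists>J \<subseteq> w ` {Suc m<..Suc m + k}. card J = c
        \<and> (\<forall>j. lcode w j = lcode v j + (if j \<in> J then 1 else 0)))"
      using Suc.prems(3,4) by (intro Suc.IH[OF True Suc.prems(2)]) auto
    then obtain J where "v permutes {1..n}" "J \<subseteq> w ` {Suc m<..Suc m + k}" "card J = c"
      "\<forall>j. lcode w j = lcode v j + (if j \<in> J then 1 else 0)" by blast
    moreover have "w ` {Suc m<..Suc m + k} \<subseteq> w ` {m<..m + Suc k}" by (intro image_mono) auto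
    ultimately show ?thesis by (intro conjI exI[of _ J]) simp_all
  next
    case False
    let ?w = "w \<circ> adj m"
    from False Suc.prems(1) obtain d where d: "c = Suc d" "pass (Suc m) k ?w d v" and desc: "w (Suc m) < w m"
      by auto
    have bij: "bij w" using Suc.prems(2) by (rule permutes_bij)
    have "?w permutes {1..n}" using Suc.prems by (intro permutes_comp_adj) auto
    from Suc.IH[OF d(2) this] Suc.prems obtain J where v: "v permutes {1..n}"
      and J: "J \<subseteq> ?w ` {Suc m<..Suc m + k}" "card J = d"
        "\<And>j. lcode ?w j = lcode v j + (if j \<in> J then 1 else 0)"
      by (auto simp del: comp_apply)
    have im: "?w ` {Suc m<..Suc m + k} = w ` {Suc m<..Suc m + k}"
      by (intro image_cong) (auto simp: Transposition.transpose_def)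
    \<comment> \<open>The overtaken value now stands at position \<open>m\<close>, out of reach of
      the rest of the pass, so it is lowered only once.\<close>
    have "w (Suc m) \<notin> w ` {Suc m<..Suc m + k}"
      by (simp only: inj_image_mem_iff[OF bij_is_inj[OF bij]]) simp
    then have "w (Suc m) \<notin> J" using J(1) unfolding im by blast
    moreover have "finite J" using J(1) by (rule finite_subset) simp
    ultimately have "card (insert (w (Suc m)) J) = c" using d(1) J(2) by simp
    moreover have "lcode w j = lcode v j + (if j \<in> insert (w (Suc m)) J then 1 else 0)" for j
      using lcode_comp_adj[OF bij desc, of j] J(3)[of j] \<open>w (Suc m) \<notin> J\<close> by auto
    moreover have "insert (w (Suc m)) J \<subseteq> w ` {m<..m + Suc k}"
      using J(1) unfolding im by auto
    ultimately show ?thesis using v by blast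
  qed
qed

text \<open>
  The last hypothesis says that the value carried along by the pass exceeds each member of \<open>J\<close>
  it meets: the pass picks up a new value exactly at the positions outside \<open>J\<close>.
\<close>

lemma pass_exists:
  assumes "w permutes {1..n}" "1 \<le> m" "m + k \<le> n" "J \<subseteq> w ` {m<..m + k}"
    and "\<And>p q. m \<le> p \<Longrightarrow> p < q \<Longrightarrow> q \<le> m + k \<Longrightarrow> w p \<notin> J \<Longrightarrow> w q \<in> J \<Longrightarrow>
      (\<And>t. p < t \<Longrightarrow> t < q \<Longrightarrow> w t \<in> J) \<Longrightarrow> w q < w p"
  shows "\<exists>v. v permutes {1..n} \<and> pass m k w (card J) v
    \<and> (\<forall>j. lcode w j = lcode v j + (if j \<in> J then 1 else 0))"
  using assms
proof (induction k arbitrary: m w J)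
  case 0
  then show ?case by auto
next
  case (Suc k)
  have bij: "bij w" using Suc.prems(1) by (rule permutes_bij)
  have eq: "w a = w b \<longleftrightarrow> a = b" for a b using bij by (simp add: bij_is_inj inj_eq)
  show ?case
  proof (cases "w (Suc m) \<in> J")
    case True
    let ?w = "w \<circ> adj m" and ?J = "J - {w (Suc m)}"
    have "w m \<notin> J" using Suc.prems(4) by (auto simp: eq)
    then have desc: "w (Suc m) < w m" using Suc.prems(5)[of m "Suc m"] True by simp
    have w': "?w t = w t" if "Suc m < t" for t using that by (simp add: Transposition.transpose_def)
    have w'_m: "?w (Suc m) = w m" by simp
    have J_iff: "w t \<in> ?J \<longleftrightarrow> w t \<in> J" if "t \<noteq> Suc m" for t using that by (simp add: eq)
    have "\<exists>v. v permutes {1..n} \<and> pass (Suc m) k ?w (card ?J) v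
      \<and> (\<forall>j. lcode ?w j = lcode v j + (if j \<in> ?J then 1 else 0))"
    proof (rule Suc.IH)
      show "?w permutes {1..n}" using Suc.prems by (intro permutes_comp_adj) auto
      show "?J \<subseteq> ?w ` {Suc m<..Suc m + k}"
      proof
        fix j assume "j \<in> ?J"
        then obtain q where q: "j = w q" "q \<in> {m<..m + Suc k}" using Suc.prems(4) by blast
        moreover have "q \<noteq> Suc m" using \<open>j \<in> ?J\<close> q(1) by blast
        ultimately have q: "j = w q" "m < q" "q \<le> m + Suc k" "q \<noteq> Suc m" by auto
        then show "j \<in> ?w ` {Suc m<..Suc m + k}" using w'[of q] by (intro image_eqI[of _ _ q]) auto
      qed
      fix p q
      assume pq: "Suc m \<le> p" "p < q" "q \<le> Suc m + k" "?w p \<notin> ?J" "?w q \<in> ?J"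
        and t: "\<And>t. p < t \<Longrightarrow> t < q \<Longrightarrow> ?w t \<in> ?J"
      have wq: "?w q = w q" "w q \<in> J" using w'[of q] pq by auto
      have wt: "w t \<in> J" if "p < t" "t < q" for t using t[OF that] w'[of t] that pq(1) by auto
      show "?w q < ?w p"
      proof (cases "p = Suc m")
        case p: True
        \<comment> \<open>The carried value now sits at \<open>Suc m\<close>; since
          \<open>w (Suc m)\<close> is in \<open>J\<close> too, the original hypothesis applies from
          position \<open>m\<close>.\<close>
        have "w q < w m"
        proof (rule Suc.prems(5))
          fix t assume "m < t" "t < q"
          then show "w t \<in> J" using wt[of t] p True by (cases "t = Suc m") auto
        qed (use pq wq p \<open>w m \<notin> J\<close> in auto)
        then show ?thesis unfolding p w'_m wq(1) .
      next
        case False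
        then have wp: "?w p = w p" using w'[of p] pq(1) by simp
        have "w p \<notin> J" using pq(4) J_iff[OF False] unfolding wp by blast
        then have "w q < w p" using pq wq wt by (intro Suc.prems(5)) auto
        then show ?thesis unfolding wp wq(1) .
      qed
    qed (use Suc.prems in auto)
    then obtain v where v: "v permutes {1..n}" "pass (Suc m) k ?w (card ?J) v"
      "\<And>j. lcode ?w j = lcode v j + (if j \<in> ?J then 1 else 0)" by blast
    have "finite J" using Suc.prems(4) by (rule finite_subset) simp
    then have "card J = Suc (card ?J)" using True by (rule card.remove)
    then have "pass m (Suc k) w (card J) v" using v(2) desc by (simp del: comp_apply)
    moreover have "lcode w j = lcode v j + (if j \<in> J then 1 else 0)" for j
      using lcode_comp_adj[OF bij desc, of j] v(3)[of j] True by auto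
    ultimately show ?thesis using v(1) by blast
  next
    case False
    have "\<exists>v. v permutes {1..n} \<and> pass (Suc m) k w (card J) v
      \<and> (\<forall>j. lcode w j = lcode v j + (if j \<in> J then 1 else 0))"
    proof (rule Suc.IH)
      show "J \<subseteq> w ` {Suc m<..Suc m + k}"
      proof
        fix j assume "j \<in> J"
        then obtain q where "j = w q" "m < q" "q \<le> m + Suc k" using Suc.prems(4) by auto
        then show "j \<in> w ` {Suc m<..Suc m + k}" using False \<open>j \<in> J\<close>
          by (cases "q = Suc m") auto
      qed
    qed (use Suc.prems in auto)
    then show ?thesis by auto
  qed
qed

lemma ex_top_subset:
  fixes f :: "'a \<Rightarrow> nat"
  assumes "finite V" "c \<le> card V"
  shows "\<exists>J \<subseteq> V. card J = c \<and> (\<forall>x\<in>J. \<forall>y\<in>V - J. f y \<le> f x)"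
  using assms(2)
proof (induction c)
  case 0
  show ?case by (rule exI[of _ "{}"]) simp
next
  case (Suc c)
  then obtain J where J: "J \<subseteq> V" "card J = c" "\<forall>x\<in>J. \<forall>y\<in>V - J. f y \<le> f x" by auto
  have "finite J" using J(1) assms(1) by (rule finite_subset)
  have "V - J \<noteq> {}"
  proof
    assume "V - J = {}"
    then have "V = J" using J(1) by blast
    then show False using J(2) Suc.prems by simp
  qed
  then have ne: "f ` (V - J) \<noteq> {}" and fin: "finite (f ` (V - J))" using assms(1) by auto
  from Max_in[OF fin ne] obtain x where x: "x \<in> V - J" "f x = Max (f ` (V - J))" by auto
  have "f y \<le> f x" if "y \<in> V - J" for y using that fin unfolding x(2) by (intro Max_ge) auto
  then have "\<forall>x'\<in>insert x J. \<forall>y\<in>V - insert x J. f y \<le> f x'" using J(3) by auto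
  moreover have "card (insert x J) = Suc c" using x(1) J(2) \<open>finite J\<close> by simp
  ultimately show ?case using x(1) J(1) by (intro exI[of _ "insert x J"]) auto
qed

lemma greedy_pass:
  assumes "n \<ge> 1" "w permutes {1..n}" "c \<le> card {j \<in> {1..n}. 0 < lcode w j}"
  obtains v J where "v permutes {1..n}" "pass 1 (n - 1) w c v" "J \<subseteq> {1..n}" "card J = c"
    "\<And>j. lcode w j = lcode v j + (if j \<in> J then 1 else 0)"
    "\<And>x y. x \<in> J \<Longrightarrow> y \<in> {1..n} - J \<Longrightarrow> lcode w y \<le> lcode w x"
proof -
  have bij: "bij w" using assms(2) by (rule permutes_bij)
  have eq: "w a = w b \<longleftrightarrow> a = b" and inv_w: "inv w (w a) = a" for a b
    using bij by (simp_all add: bij_is_inj inj_eq)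
  have w_inv: "w (inv w j) = j" for j using bij by (simp add: bij_is_surj surj_f_inv_f)
  have w_in: "w i \<in> {1..n} \<longleftrightarrow> i \<in> {1..n}" for i using assms(2) by (rule permutes_in_image)
  \<comment> \<open>orders values by their code and, among equal codes, by position from left to right\<close>
  define f where "f j = lcode w j * Suc n + (n - inv w j)" for j
  have "card {j \<in> {1..n}. 0 < lcode w j} \<le> card {1..n}" by (rule card_mono) auto
  then have "c \<le> card {1..n}" using assms(3) by simp
  from ex_top_subset[OF _ this, of f] obtain J where J: "J \<subseteq> {1..n}" "card J = c"
    "\<And>x y. x \<in> J \<Longrightarrow> y \<in> {1..n} - J \<Longrightarrow> f y \<le> f x" by auto
  have finJ: "finite J" using J(1) by (rule finite_subset) simp
  have top: "lcode w y \<le> lcode w x" if "x \<in> J" "y \<in> {1..n} - J" for x y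
  proof (rule ccontr)
    assume "\<not> ?thesis"
    then have "Suc (lcode w x) * Suc n \<le> lcode w y * Suc n" by (intro mult_le_mono1) simp
    then have "f x < f y" by (simp add: f_def)
    then show False using J(3)[OF that] by simp
  qed
  have tie: "inv w x \<le> inv w y" if "x \<in> J" "y \<in> {1..n} - J" "lcode w y = lcode w x" for x y
  proof -
    have "inv w x \<in> {1..n}" using w_in[of "inv w x"] that J(1) by (auto simp: w_inv)
    then show ?thesis using J(3)[OF that(1,2)] that(3) by (auto simp: f_def)
  qed
  have pos: "0 < lcode w x" if "x \<in> J" for x
  proof (rule ccontr)
    assume "\<not> 0 < lcode w x"
    \<comment> \<open>Every value of positive code would beat \<open>x\<close> and lie in
      \<open>J\<close> already, making \<open>J\<close> too large.\<close>
    then have "{j \<in> {1..n}. 0 < lcode w j} \<subseteq> J - {x}" using top[OF that] by fastforce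
    then have "card {j \<in> {1..n}. 0 < lcode w j} \<le> card (J - {x})" using finJ by (intro card_mono) auto
    also have "\<dots> < c" using that finJ J(2) by (metis card_Diff1_less)
    finally show False using assms(3) by simp
  qed
  have "w 0 = 0" using assms(2) by (simp add: permutes_not_in)
  \<comment> \<open>A pass cannot lower the leftmost value. Position 0 is further left but holds the
    value 0, so it adds nothing to the code.\<close>
  have first: "lcode w (w 1) = 0"
  proof -
    have "bef w (w 1) = {}"
    proof (rule equals0I)
      fix l assume l: "l \<in> bef w (w 1)"
      then have "inv w l = 0" by (simp add: bef_def inv_w)
      then have "l = 0" using w_inv[of l] \<open>w 0 = 0\<close> by simp
      then show False using l by (simp add: bef_def)
    qed
    then show ?thesis by (simp add: lcode_def)
  qed
  have n: "1 + (n - 1) = n" using assms(1) by simp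
  have "\<exists>v. v permutes {1..n} \<and> pass 1 (n - 1) w (card J) v
    \<and> (\<forall>j. lcode w j = lcode v j + (if j \<in> J then 1 else 0))"
  proof (rule pass_exists[OF assms(2)])
    show "J \<subseteq> w ` {1<..1 + (n - 1)}"
    proof
      fix j assume "j \<in> J"
      have "inv w j \<noteq> 1" using pos[OF \<open>j \<in> J\<close>] first w_inv[of j] by auto
      moreover have "inv w j \<in> {1..n}" using w_in[of "inv w j"] \<open>j \<in> J\<close> J(1) by (auto simp: w_inv)
      ultimately show "j \<in> w ` {1<..1 + (n - 1)}"
        unfolding n by (intro image_eqI[of _ _ "inv w j"]) (auto simp: w_inv)
    qed
    fix p q
    assume pq: "1 \<le> p" "p < q" "q \<le> 1 + (n - 1)" "w p \<notin> J" "w q \<in> J"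
      and between: "\<And>t. p < t \<Longrightarrow> t < q \<Longrightarrow> w t \<in> J"
    show "w q < w p"
    proof (rule ccontr)
      assume "\<not> w q < w p"
      then have "w p < w q" using pq(2) eq[of p q] by auto
      \<comment> \<open>The first larger value after \<open>p\<close> also lies in \<open>J\<close>.
        Whatever exceeds it on its left stands before \<open>p\<close>, so the code of
        \<open>w p\<close> is at least as large, and the tie-break by position favours
        \<open>w p\<close>.\<close>
      define q' where "q' = (LEAST s. p < s \<and> w p < w s)"
      have q': "p < q'" "w p < w q'" "q' \<le> q"
        using LeastI[of "\<lambda>s. p < s \<and> w p < w s" q] Least_le[of "\<lambda>s. p < s \<and> w p < w s" q] pq(2) \<open>w p < w q\<close>
        by (auto simp: q'_def)
      have least: "w s \<le> w p" if "p < s" "s < q'" for s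
        using not_less_Least[of s "\<lambda>s. p < s \<and> w p < w s"] that by (auto simp: q'_def)
      have "w q' \<in> J" using between[of q'] q' pq(5) by (cases "q' = q") auto
      have "bef w (w q') \<subseteq> bef w (w p)"
      proof
        fix l assume "l \<in> bef w (w q')"
        then have l: "w q' < l" "inv w l < q'" by (auto simp: bef_def inv_w)
        have "\<not> p < inv w l" using least[of "inv w l"] l q' by (auto simp: w_inv)
        moreover have "inv w l \<noteq> p" using l q' w_inv[of l] by auto
        ultimately show "l \<in> bef w (w p)" using l q' by (auto simp: bef_def inv_w)
      qed
      then have "lcode w (w q') \<le> lcode w (w p)"
        unfolding lcode_def by (intro card_mono finite_bef bij)
      moreover have wp: "w p \<in> {1..n} - J" using pq w_in[of p] n by auto
      ultimately have "lcode w (w p) = lcode w (w q')" using top[OF \<open>w q' \<in> J\<close> wp] by simp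
      from tie[OF \<open>w q' \<in> J\<close> wp this] show False using q'(1) by (simp add: inv_w)
    qed
  qed (use assms(1) in auto)
  then show thesis using that J(1,2) top by blast
qed

section \<open>The Gale-Ryser inequalities\<close>

lemma len_id: "len n id = 0"
  by (simp add: len_def lcode_def bef_def)

lemma len_eq_0:
  assumes "w permutes {1..n}" "len n w = 0"
  shows "w = id"
proof
  fix i
  have w_in: "w i \<in> {1..n} \<longleftrightarrow> i \<in> {1..n}" for i using assms(1) by (rule permutes_in_image)
  have asc: "w j < w (Suc j)" if "1 \<le> j" "j < n" for j
  proof (rule ccontr)
    assume "\<not> ?thesis"
    moreover have "w (Suc j) \<noteq> w j" by (simp add: inj_eq[OF permutes_inj[OF assms(1)]])
    ultimately have "w (Suc j) < w j" by simp
    from len_comp_adj[OF assms(1) that this] show False using assms(2) by simp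
  qed
  show "w i = id i"
  proof (cases "i \<in> {1..n}")
    case True
    show ?thesis using increasing_eq_id[of n w i] w_in asc True by simp
  qed (simp add: permutes_not_in[OF assms(1)])
qed

lemma sum_indicator:
  "J \<subseteq> {1..n} \<Longrightarrow> (\<Sum>j=1..n. if j \<in> J then 1 else 0) = card (J :: nat set)"
  by (simp add: sum.If_cases Int_absorb1)

text \<open>The sum of the minima for |S| = k is the sum of the first k parts of the conjugate of
  the sorted code, so this is dominance order between the sorted exponents and that
  conjugate.\<close>

definition dominated :: "nat \<Rightarrow> nat \<Rightarrow> (nat \<Rightarrow> nat) \<Rightarrow> expo \<Rightarrow> bool" where
  "dominated n m w \<alpha> \<longleftrightarrow> (\<Sum>i=1..m. Poly_Mapping.lookup \<alpha> i) = len n w \<and>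
    (\<forall>S\<subseteq>{1..m}. (\<Sum>i\<in>S. Poly_Mapping.lookup \<alpha> i) \<le> (\<Sum>j=1..n. min (card S) (lcode w j)))"

lemma sum_update:
  assumes "S \<subseteq> {1..m}"
  shows "(\<Sum>i\<in>S. Poly_Mapping.lookup (Poly_Mapping.update (Suc m) 0 \<alpha>) i) = (\<Sum>i\<in>S. Poly_Mapping.lookup \<alpha> i)"
  using assms by (intro sum.cong) (auto simp: lookup_update)

lemma len_add:
  assumes "\<And>j. lcode w j = lcode v j + (if j \<in> J then 1 else 0)" "J \<subseteq> {1..n}"
  shows "len n w = len n v + card J"
  using sum_indicator[OF assms(2)] by (simp add: len_def assms(1) sum.distrib)

lemma dominated_if_stan:
  assumes "n \<ge> 1" "w permutes {1..n}" "0 < Poly_Mapping.lookup (stan n {1..m} w) \<alpha>"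
  shows "dominated n m w \<alpha>"
  using assms(2,3)
proof (induction m arbitrary: w \<alpha>)
  case 0
  have "w = id"
  proof
    fix i show "w i = id i"
      using 0 permutes_not_in[OF 0(1), of 0] by (cases "i = 0") (auto simp: delta_def split: if_splits)
  qed
  then show ?case by (simp only: dominated_def len_id) auto
next
  case (Suc m)
  let ?c = "Poly_Mapping.lookup \<alpha> (Suc m)" and ?\<beta> = "Poly_Mapping.update (Suc m) 0 \<alpha>"
  from Suc.prems(2) obtain v where v: "pass 1 (n - 1) w ?c v" "0 < Poly_Mapping.lookup (stan n {1..m} v) ?\<beta>"
    unfolding stan_Suc_pos_iff by blast
  have "1 + (n - 1) \<le> n" using assms(1) by simp
  from pass_lcode[OF v(1) Suc.prems(1) _ this] obtain J where "v permutes {1..n}"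
    and J: "J \<subseteq> w ` {1<..1 + (n - 1)}" "card J = ?c" "\<And>j. lcode w j = lcode v j + (if j \<in> J then 1 else 0)"
    by blast
  have "w ` {1<..1 + (n - 1)} \<subseteq> w ` {1..n}" using assms(1) by (intro image_mono) auto
  also have "w ` {1..n} = {1..n}" using Suc.prems(1) by (rule permutes_image)
  finally have "w ` {1<..1 + (n - 1)} \<subseteq> {1..n}" .
  then have Jn: "J \<subseteq> {1..n}" using J(1) by blast
  from Suc.IH[OF \<open>v permutes {1..n}\<close> v(2)] have IH: "dominated n m v ?\<beta>" .
  have "(\<Sum>i\<in>S. Poly_Mapping.lookup \<alpha> i) \<le> (\<Sum>j=1..n. min (card S) (lcode w j))" if S: "S \<subseteq> {1..Suc m}" for S
  proof -
    let ?S = "S - {Suc m}"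
    have S': "?S \<subseteq> {1..m}" using S by (auto simp: le_Suc_eq)
    have "finite S" using S by (rule finite_subset) simp
    have le: "(\<Sum>i\<in>?S. Poly_Mapping.lookup \<alpha> i) \<le> (\<Sum>j=1..n. min (card ?S) (lcode v j))"
      using IH S' sum_update[OF S', of \<alpha>] unfolding dominated_def by metis
    show ?thesis
    proof (cases "Suc m \<in> S")
      case True
      have card: "card S = Suc (card ?S)" using \<open>finite S\<close> True by (rule card.remove)
      have "(\<Sum>i\<in>S. Poly_Mapping.lookup \<alpha> i) = ?c + (\<Sum>i\<in>?S. Poly_Mapping.lookup \<alpha> i)"
        using \<open>finite S\<close> True by (rule sum.remove)
      also have "\<dots> \<le> (\<Sum>j=1..n. (if j \<in> J then 1 else 0)) + (\<Sum>j=1..n. min (card ?S) (lcode v j))"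
        using le sum_indicator[OF Jn] J(2) by simp
      \<comment> \<open>Entrywise: raising code and cap together by one raises the minimum by
        one.\<close>
      also have "\<dots> \<le> (\<Sum>j=1..n. min (card S) (lcode w j))"
        unfolding sum.distrib[symmetric] card by (intro sum_mono) (simp add: J(3) min_def)
      finally show ?thesis .
    next
      case False
      then have "?S = S" by blast
      with le have "(\<Sum>i\<in>S. Poly_Mapping.lookup \<alpha> i) \<le> (\<Sum>j=1..n. min (card S) (lcode v j))" by simp
      also have "\<dots> \<le> (\<Sum>j=1..n. min (card S) (lcode w j))"
        by (intro sum_mono) (simp add: J(3))
      finally show ?thesis .
    qed
  qed
  moreover have "(\<Sum>i=1..Suc m. Poly_Mapping.lookup \<alpha> i) = len n w"
    using IH sum_update[of "{1..m}" m \<alpha>] len_add[OF J(3) Jn] J(2) by (simp add: dominated_def)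
  ultimately show ?case by (simp add: dominated_def)
qed

text \<open>As in the Gale-Ryser theorem, removing the last row greedily preserves the inequalities.\<close>

lemma stan_if_dominated:
  assumes "n \<ge> 1" "w permutes {1..n}" "Poly_Mapping.keys \<alpha> \<subseteq> {1..m}" "dominated n m w \<alpha>"
  shows "0 < Poly_Mapping.lookup (stan n {1..m} w) \<alpha>"
  using assms(2-4)
proof (induction m arbitrary: w \<alpha>)
  case 0
  then have "w = id" using len_eq_0[of w n] by (simp add: dominated_def)
  moreover have "\<alpha> = 0" using 0 by simp
  ultimately show ?case by (simp add: delta_def)
next
  case (Suc m)
  let ?c = "Poly_Mapping.lookup \<alpha> (Suc m)" and ?\<beta> = "Poly_Mapping.update (Suc m) 0 \<alpha>"
  have dom: "(\<Sum>i\<in>S. Poly_Mapping.lookup \<alpha> i) \<le> (\<Sum>j=1..n. min (card S) (lcode w j))" if "S \<subseteq> {1..Suc m}" for S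
    using Suc.prems(3) that by (simp add: dominated_def)
  \<comment> \<open>The singleton inequality is exactly what the greedy pass requires.\<close>
  have "?c \<le> (\<Sum>j=1..n. min 1 (lcode w j))" using dom[of "{Suc m}"] by simp
  also have "\<dots> = (\<Sum>j=1..n. if j \<in> {j \<in> {1..n}. 0 < lcode w j} then 1 else 0)"
    by (intro sum.cong) auto
  also have "\<dots> = card {j \<in> {1..n}. 0 < lcode w j}" by (rule sum_indicator) auto
  finally obtain v J where v: "v permutes {1..n}" "pass 1 (n - 1) w ?c v" and J: "J \<subseteq> {1..n}" "card J = ?c"
    and vw: "\<And>j. lcode w j = lcode v j + (if j \<in> J then 1 else 0)"
    and top: "\<And>x y. x \<in> J \<Longrightarrow> y \<in> {1..n} - J \<Longrightarrow> lcode w y \<le> lcode w x"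
    using greedy_pass[OF assms(1) Suc.prems(1)] by blast
  have "(\<Sum>i\<in>S. Poly_Mapping.lookup ?\<beta> i) \<le> (\<Sum>j=1..n. min (card S) (lcode v j))" if S: "S \<subseteq> {1..m}" for S
  \<comment> \<open>If all lowered entries exceed the cap \<open>card S\<close>, the capped sum is
    unchanged. Otherwise all entries outside \<open>J\<close> are within the cap as well, and the
    inequality for \<open>insert (Suc m) S\<close> drops by exactly \<open>?c\<close> on both
    sides.\<close>
  proof (cases "\<forall>x\<in>J. card S < lcode w x")
    case True
    have "(\<Sum>i\<in>S. Poly_Mapping.lookup ?\<beta> i) \<le> (\<Sum>j=1..n. min (card S) (lcode w j))"
      unfolding sum_update[OF S] using S by (intro dom) auto
    also have "\<dots> = (\<Sum>j=1..n. min (card S) (lcode v j))"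
      using True by (intro sum.cong) (auto simp: vw)
    finally show ?thesis .
  next
    case False
    then obtain x where x: "x \<in> J" "lcode w x \<le> card S" by force
    have "finite S" using S by (rule finite_subset) simp
    moreover have "Suc m \<notin> S" using S by auto
    ultimately have ins: "card (insert (Suc m) S) = Suc (card S)"
      "(\<Sum>i\<in>insert (Suc m) S. Poly_Mapping.lookup \<alpha> i) = ?c + (\<Sum>i\<in>S. Poly_Mapping.lookup \<alpha> i)" by simp_all
    have "insert (Suc m) S \<subseteq> {1..Suc m}" using S by auto
    from dom[OF this] have "?c + (\<Sum>i\<in>S. Poly_Mapping.lookup ?\<beta> i) \<le> (\<Sum>j=1..n. min (Suc (card S)) (lcode w j))"
      unfolding ins sum_update[OF S] .
    also have "\<dots> = (\<Sum>j=1..n. (if j \<in> J then 1 else 0) + min (card S) (lcode v j))"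
    proof (intro sum.cong refl)
      fix j assume j: "j \<in> {1..n}"
      show "min (Suc (card S)) (lcode w j) = (if j \<in> J then 1 else 0) + min (card S) (lcode v j)"
      proof (cases "j \<in> J")
        case False
        then show ?thesis using top[OF x(1), of j] x(2) j vw[of j] by auto
      qed (simp add: vw)
    qed
    also have "\<dots> = ?c + (\<Sum>j=1..n. min (card S) (lcode v j))"
      using sum_indicator[OF J(1)] J(2) by (simp add: sum.distrib)
    finally show ?thesis by simp
  qed
  moreover have "(\<Sum>i=1..m. Poly_Mapping.lookup ?\<beta> i) = len n v"
    using Suc.prems(3) sum_update[of "{1..m}" m \<alpha>] len_add[OF vw J(1)] J(2) by (simp add: dominated_def)
  ultimately have "dominated n m v ?\<beta>" by (simp add: dominated_def)
  moreover have "Poly_Mapping.keys ?\<beta> \<subseteq> {1..m}"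
    using Suc.prems(2) by (force simp: keys_update le_Suc_eq)
  ultimately have "0 < Poly_Mapping.lookup (stan n {1..m} v) ?\<beta>" using v(1) by (intro Suc.IH)
  then show ?case unfolding stan_Suc_pos_iff using v(2) by blast
qed

lemma keys_stan_iff:
  assumes "n \<ge> 1" "w permutes {1..n}"
  shows "\<alpha> \<in> Poly_Mapping.keys (stan n {1..m} w) \<longleftrightarrow> Poly_Mapping.keys \<alpha> \<subseteq> {1..m} \<and> dominated n m w \<alpha>"
proof -
  have "\<alpha> \<in> Poly_Mapping.keys (stan n {1..m} w) \<longleftrightarrow> 0 < Poly_Mapping.lookup (stan n {1..m} w) \<alpha>"
    using stan_nonneg[of "{1..m}" n w \<alpha>] by (auto simp: in_keys_iff)
  moreover have "Poly_Mapping.keys \<alpha> \<subseteq> {1..m}" if "0 < Poly_Mapping.lookup (stan n {1..m} w) \<alpha>"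
    using that by (intro keys_stan[of _ n w]) auto
  ultimately show ?thesis
    using dominated_if_stan[OF assms] stan_if_dominated[OF assms] by blast
qed

section \<open>Saturation\<close>

lemma lookup_real_vec [simp]: "Poly_Mapping.lookup (real_vec \<alpha>) i = real (Poly_Mapping.lookup \<alpha> i)"
  by (simp add: real_vec_def Poly_Mapping.map.rep_eq when_def)

lemma lookup_scaleR: "Poly_Mapping.lookup (r *\<^sub>R p) i = r *\<^sub>R Poly_Mapping.lookup p i"
proof -
  have "finite {i. r *\<^sub>R Poly_Mapping.lookup p i \<noteq> 0}"
    by (rule finite_subset[OF _ finite_lookup[of p]]) auto
  then show ?thesis by (simp add: scaleR_poly_mapping_def)
qed

lemma SNP_stan:
  assumes "n \<ge> 1" "w permutes {1..n}"
  shows "SNP (stan n {1..m} w)"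
  unfolding SNP_def
proof (intro ballI impI)
  fix p assume p: "p \<in> newton_polytope (stan n {1..m} w)" and int: "\<forall>i. Poly_Mapping.lookup p i \<in> \<int>"
  let ?K = "Poly_Mapping.keys (stan n {1..m} w)"
  define b where "b S = (\<Sum>j=1..n. min (card S) (lcode w j))" for S :: "nat set"
  \<comment> \<open>The real relaxation of the support conditions: being convex, it contains the
    Newton polytope, and its lattice points are exponents by \<open>keys_stan_iff\<close>.\<close>
  define C where "C = {p :: nat \<Rightarrow>\<^sub>0 real. (\<forall>i. 0 \<le> Poly_Mapping.lookup p i) \<and>
    (\<forall>i. i \<notin> {1..m} \<longrightarrow> Poly_Mapping.lookup p i = 0) \<and>
    (\<Sum>i=1..m. Poly_Mapping.lookup p i) = real (len n w) \<and>
    (\<forall>S\<subseteq>{1..m}. (\<Sum>i\<in>S. Poly_Mapping.lookup p i) \<le> real (b S))}"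
  have "convex C"
  proof (rule convexI)
    fix x y :: "nat \<Rightarrow>\<^sub>0 real" and u v :: real
    assume xy: "x \<in> C" "y \<in> C" and uv: "0 \<le> u" "0 \<le> v" "u + v = 1"
    have sum: "(\<Sum>i\<in>S. Poly_Mapping.lookup (u *\<^sub>R x + v *\<^sub>R y) i)
        = u * (\<Sum>i\<in>S. Poly_Mapping.lookup x i) + v * (\<Sum>i\<in>S. Poly_Mapping.lookup y i)" for S
      by (simp add: lookup_add lookup_scaleR sum.distrib sum_distrib_left)
    have "u * a + v * a' \<le> c" if "a \<le> c" "a' \<le> c" for a a' c
      using convex_bound_le[OF that uv] .
    moreover have "u * c + v * c = c" for c using uv by (simp flip: distrib_right)
    ultimately show "u *\<^sub>R x + v *\<^sub>R y \<in> C"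
      using xy uv unfolding C_def mem_Collect_eq sum by (simp add: lookup_add lookup_scaleR)
  qed
  moreover have "real_vec ` ?K \<subseteq> C"
  proof
    fix x assume "x \<in> real_vec ` ?K"
    then obtain \<alpha> where \<alpha>: "x = real_vec \<alpha>" "Poly_Mapping.keys \<alpha> \<subseteq> {1..m}" "dominated n m w \<alpha>"
      using keys_stan_iff[OF assms] by auto
    have *: "(\<Sum>i=1..m. Poly_Mapping.lookup \<alpha> i) = len n w"
      "\<And>S. S \<subseteq> {1..m} \<Longrightarrow> (\<Sum>i\<in>S. Poly_Mapping.lookup \<alpha> i) \<le> b S"
      using \<alpha>(3) by (auto simp: dominated_def b_def)
    have "Poly_Mapping.lookup \<alpha> i = 0" if "i \<notin> {1..m}" for i
      using \<alpha>(2) that in_keys_iff[of i \<alpha>] by blast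
    then show "x \<in> C"
      unfolding C_def mem_Collect_eq \<alpha>(1) lookup_real_vec of_nat_sum[symmetric] of_nat_le_iff of_nat_eq_iff
      using * by simp
  qed
  ultimately have "p \<in> C" using p hull_minimal[of "real_vec ` ?K" C convex] by (auto simp: newton_polytope_def)
  then have C: "\<And>i. 0 \<le> Poly_Mapping.lookup p i" "\<And>i. i \<notin> {1..m} \<Longrightarrow> Poly_Mapping.lookup p i = 0"
    "(\<Sum>i=1..m. Poly_Mapping.lookup p i) = real (len n w)"
    "\<And>S. S \<subseteq> {1..m} \<Longrightarrow> (\<Sum>i\<in>S. Poly_Mapping.lookup p i) \<le> real (b S)"
    unfolding C_def by blast+
  \<comment> \<open>Rounding is exact, as the coordinates are nonnegative integers.\<close>
  define \<alpha> where "\<alpha> = Poly_Mapping.map (\<lambda>x. nat \<lfloor>x\<rfloor>) p"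
  have lookup: "real (Poly_Mapping.lookup \<alpha> i) = Poly_Mapping.lookup p i" for i
    using int C(1)[of i] by (auto simp: \<alpha>_def Poly_Mapping.map.rep_eq when_def elim!: Ints_cases[of "Poly_Mapping.lookup p i"])
  have p_eq: "p = real_vec \<alpha>" by (rule poly_mapping_eqI) (simp add: lookup)
  have "Poly_Mapping.keys \<alpha> \<subseteq> {1..m}"
    using C(2) lookup by (metis in_keys_iff of_nat_0_eq_iff subsetI)
  moreover have "dominated n m w \<alpha>"
    using C(3,4) unfolding lookup[symmetric] of_nat_sum[symmetric] of_nat_le_iff of_nat_eq_iff
    by (simp add: dominated_def b_def)
  ultimately have "\<alpha> \<in> ?K" unfolding keys_stan_iff[OF assms] by (rule conjI)
  then show "p \<in> real_vec ` ?K" unfolding p_eq by (rule imageI)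
qed

lemma stanley_degree:
  assumes "n \<ge> 1" "w permutes {1..n}" "stanley n w \<alpha> \<noteq> 0"
  shows "total_degree \<alpha> = len n w"
proof -
  have keys: "Poly_Mapping.keys \<alpha> \<subseteq> {1..}" by (rule stanley_keys[OF assms])
  obtain m where m: "Poly_Mapping.keys \<alpha> \<subseteq> {..m}"
    using finite_nat_set_iff_bounded_le[of "Poly_Mapping.keys \<alpha>"] by auto
  have sub: "Poly_Mapping.keys \<alpha> \<subseteq> {1..m}" using keys m by auto
  have "stanley n w \<alpha> = Poly_Mapping.lookup (stan n {1..m} w) \<alpha>"
    using sub by (intro stanley_eq_stan assms(1,2)) auto
  then have "\<alpha> \<in> Poly_Mapping.keys (stan n {1..m} w)" using assms(3) by (simp add: in_keys_iff)
  then have "(\<Sum>i=1..m. Poly_Mapping.lookup \<alpha> i) = len n w"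
    unfolding keys_stan_iff[OF assms(1,2)] dominated_def by blast
  moreover have "(\<Sum>i=1..m. Poly_Mapping.lookup \<alpha> i) = total_degree \<alpha>"
    unfolding total_degree_def using sub by (intro sum.mono_neutral_right) (auto simp: in_keys_iff)
  ultimately show ?thesis by simp
qed

theorem theorem5p8:
  fixes n :: nat and w :: "nat \<Rightarrow> nat"
  assumes "n \<ge> 1" and "w permutes {1..n}"
  shows "stanley n w \<in> Sym \<and> SNP_sym (stanley n w)"
proof
  show "stanley n w \<in> Sym"
    unfolding Sym_def
    using stanley_keys[OF assms] stanley_degree[OF assms] stanley_symmetric[OF assms] by auto
  show "SNP_sym (stanley n w)"
    by (simp add: SNP_sym_def restrict_vars_stanley[OF assms] SNP_stan[OF assms] del: One_nat_def)
qed

end
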